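(* The sets $\mathrm{SPP}(5)$ and $\mathrm{SPP}(6)$ are \begin{align*} \mathrm{SPP}(5) &= \{(i,j) : 12\le i\le 15,\ 12\le j\le 15\}\cup\{(9,14),(9,15),(10,12),(10,14),(10,15),\\ &\qquad (11,12),(11,14),(11,15),(15,9),(15,10),(15,11)\},\\ \mathrm{SPP}(6) &= \{(i,j) : 15\le i\le 21,\ 15\le j\le 21\}\cup\{(21,11),(21,12),(21,13),(21,14),\\ &\qquad (13,15),(14,15),(14,19),(13,19)\}\cup\{(i,j) : 11\le i\le 14,\ j\in\{18,20,21\}\}, \end{align*} and the sets $\mathrm{SPP}_{\mathbb{R}_+}(5)$ and $\mathrm{SPP}_{\mathbb{R}_+}(6)$ are \begin{align*} \mathrm{SPP}_{\mathbb{R}_+}(5) &= \mathrm{SPP}(5)\cup\{(i,j) : 13\le i\le 14,\ 9\le j\le 11\},\\ \mathrm{SPP}_{\mathbb{R}_+}(6) &= \mathrm{SPP}(6)\cup\{(i,j) : 18\le i\le 20,\ 11\le j\le 14\}, \end{align*} where $i,j$ denote integers.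
   Context: For a finite set $A$ of real numbers, $A+A=\{x+y : x,y\in A\}$ and $AA=\{xy : x,y\in A\}$ (here $x=y$ is allowed). For a set $X$ of real numbers and a positive integer $n$, define the set of sum-product pairs $\mathrm{SPP}_X(n)=\{(|A+A|,|AA|) : A\subseteq X,\ |A|=n\}$. Write $\mathrm{SPP}(n)=\mathrm{SPP}_{\mathbb{N}}(n)$, where $\mathbb{N}$ is the set of positive integers, and let $\mathbb{R}_+$ be the set of positive real numbers. *)

theory Defs
  imports Complex_Main "HOL-Library.Set_Algebras"
begin

(* On sets, + and * are the elementwise operations of Set_Algebras:
   A + A = {x + y | x y. x \<in> A \<and> y \<in> A}, and likewise for A * A. *)

definition SPP_on :: "real set \<Rightarrow> nat \<Rightarrow> (nat \<times> nat) set" where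
  "SPP_on X n = {(card (A + A), card (A * A)) |A. A \<subseteq> X \<and> finite A \<and> card A = n}"

(* The library set \<nat> contains 0, whereas the natural numbers meant here are positive. *)
definition SPP :: "nat \<Rightarrow> (nat \<times> nat) set" where
  "SPP n = SPP_on (\<nat> - {0}) n"

end

theory Submission
  imports Defs
begin

text \<open>
  If \<^term>\<open>card (A + A) \<le> 3 * card A - 4\<close>, then \<open>A\<close> is \<open>a + d K\<close> for a set \<open>K\<close> of at most
  \<open>2 |A| - 3\<close> consecutive integers (Freiman). For such \<open>A\<close> put \<open>x = a / d\<close>: two products
  \<open>(x + k) (x + l)\<close> and \<open>(x + m) (x + n)\<close> agree only for the single value
  \<open>x = (m n - k l) / (k + l - m - n)\<close>, so finitely many rational \<open>x\<close> have to be inspected.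
  Applied to \<open>ln ` A\<close>, Freiman's theorem shows that a set with few products is \<open>c r\<^sup>k\<close>, \<open>k \<in> K\<close>, with
  \<open>r > 1\<close>. Two of its sums agree exactly if \<open>r\<^sup>n + 1 = r\<^sup>l + r\<^sup>m\<close> for some \<open>0 < l \<le> m < n \<le> 8\<close>. Each of
  these trinomials has at most one root above 1; the roots are separated by rational numbers, and
  counting the coincidences in \<open>K\<close> for each root bounds \<open>|A + A|\<close> from below. By the rational
  root theorem none of the roots is rational, so for integers all sums are distinct.
\<close>

section \<open>Small sumsets and arithmetic progressions\<close>

text \<open>Each unordered pair has one entry, the diagonal included, so \<open>n\<close> elements
  give \<open>n (n + 1) / 2\<close> entries: the trivial upper bound for the number of sums or
  products.\<close>

fun map_upairs :: "('a \<Rightarrow> 'a \<Rightarrow> 'b) \<Rightarrow> 'a list \<Rightarrow> 'b list" where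
  "map_upairs f [] = []"
| "map_upairs f (x # xs) = map (f x) (x # xs) @ map_upairs f xs"

lemma set_map_upairs:
  assumes comm: "\<And>a b. f a b = f b a"
  shows "set (map_upairs f xs) = {f a b | a b. a \<in> set xs \<and> b \<in> set xs}"
proof (intro subset_antisym subsetI)
  fix y assume "y \<in> set (map_upairs f xs)"
  thus "y \<in> {f a b | a b. a \<in> set xs \<and> b \<in> set xs}"
    by (induction xs) auto
next
  have "f a b \<in> set (map_upairs f xs)" if "a \<in> set xs" "b \<in> set xs" for a b
    using that
  proof (induction xs)
    case (Cons x xs)
    then consider "a = x" | "b = x" | "a \<in> set xs" "b \<in> set xs" by auto
    thus ?case
    proof cases
      case 2
      have "f b a \<in> set (map_upairs f (x # xs))" using Cons.prems(1) 2 by auto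
      thus ?thesis by (subst comm)
    qed (use Cons in auto)
  qed simp
  thus "y \<in> set (map_upairs f xs)" if "y \<in> {f a b | a b. a \<in> set xs \<and> b \<in> set xs}" for y
    using that by blast
qed

lemma map_map_upairs: "map g (map_upairs f xs) = map_upairs (\<lambda>a b. g (f a b)) xs"
  by (induction xs) auto

lemma map_upairs_map: "map_upairs f (map g xs) = map_upairs (\<lambda>a b. f (g a) (g b)) xs"
  by (induction xs) auto

definition sum_count :: "int list \<Rightarrow> nat" where
  "sum_count xs = length (remdups (map_upairs (+) xs))"

lemma set_plus_eq: "set xs + set xs = set (map_upairs (+) xs)" for xs :: "'a::ab_semigroup_add list"
  by (subst set_map_upairs) (auto simp: set_plus_def add.commute)

lemma set_times_eq: "set xs * set xs = set (map_upairs (*) xs)" for xs :: "'a::ab_semigroup_mult list"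
  by (subst set_map_upairs) (auto simp: set_times_def mult.commute)

(* Normalised index sets: n-element subsets of {0..M} that contain 0, as increasing lists. *)
definition ksets :: "nat \<Rightarrow> int \<Rightarrow> int list list" where
  "ksets n M = map ((#) 0) (filter (\<lambda>xs. length xs = n - 1) (subseqs [1..M]))"

lemma set_subset_of_subseqs: "ys \<in> set (subseqs xs) \<Longrightarrow> set ys \<subseteq> set xs"
  using subseqs_powset[of xs] imageI[of ys "set (subseqs xs)" set] by simp

lemma sorted_wrt_subseqs:
  "ys \<in> set (subseqs xs) \<Longrightarrow> sorted_wrt P xs \<Longrightarrow> sorted_wrt P ys"
proof (induction xs arbitrary: ys)
  case (Cons x xs)
  show ?case
  proof (cases "ys \<in> set (subseqs xs)")
    case False
    then obtain zs where "zs \<in> set (subseqs xs)" "ys = x # zs"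
      using Cons.prems(1) by (auto simp: Let_def)
    thus ?thesis using Cons.IH[of zs] Cons.prems(2) set_subset_of_subseqs[of zs xs] by auto
  qed (use Cons in simp)
qed simp

text \<open>The extra \<open>{0}\<close> in the last conclusion covers negative \<open>M\<close>,
  where \<open>{0..M}\<close> is empty. For \<open>n = 0\<close> the truncated \<open>n - 1\<close>
  would falsify the claim on the length.\<close>

lemma ksetsD:
  assumes "xs \<in> set (ksets n M)" "0 < n"
  shows "sorted_wrt (<) xs" "length xs = n" "0 \<in> set xs" "set xs \<subseteq> {0..M} \<union> {0}"
proof -
  obtain ys where ys: "ys \<in> set (subseqs [1..M])" "length ys = n - 1" "xs = 0 # ys"
    using assms(1) unfolding ksets_def by auto
  have sub: "set ys \<subseteq> {1..M}" using set_subset_of_subseqs[OF ys(1)] by simp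
  have sorted: "sorted_wrt (<) ys"
    by (rule sorted_wrt_subseqs[OF ys(1)]) simp
  show "sorted_wrt (<) xs" using sub sorted unfolding ys(3) by auto
  show "length xs = n" using ys(2,3) assms(2) by simp
  show "0 \<in> set xs" "set xs \<subseteq> {0..M} \<union> {0}" using sub unfolding ys(3) by auto
qed

lemma ksets_cover:
  assumes "K \<subseteq> {0..M}" "0 \<in> K" "card K = n"
  obtains xs where "xs \<in> set (ksets n M)" "set xs = K"
proof -
  have fin: "finite K" using assms finite_subset by blast
  have "K - {0} \<subseteq> set [1..M]" using assms(1) by auto
  from subset_subseqs[OF this]
  obtain ys where ys: "ys \<in> set (subseqs [1..M])" "K - {0} = set ys" by (elim imageE)
  have "distinct ys" using subseqs_distinctD[OF ys(1)] by simp
  hence "length ys = card (K - {0})" unfolding ys(2) by (rule distinct_card[symmetric])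
  hence "length ys = n - 1" using assms fin by simp
  hence "0 # ys \<in> set (ksets n M)" using ys(1) unfolding ksets_def by simp
  moreover have "set (0 # ys) = K" using ys(2) assms(2) by auto
  ultimately show ?thesis by (rule that)
qed

section \<open>Sets contained in short arithmetic progressions\<close>

definition in_ap :: "nat \<Rightarrow> int \<Rightarrow> real set \<Rightarrow> bool" where
  "in_ap n M A \<longleftrightarrow> (\<exists>a d. 0 < d \<and> (\<exists>xs \<in> set (ksets n M). A = (\<lambda>k. a + d * of_int k) ` set xs))"

lemma in_apI:
  assumes "A = (\<lambda>k. a + d * of_int k) ` K" "0 < d" "K \<subseteq> {0..M}" "0 \<in> K" "card A = n"
  shows "in_ap n M A"
proof -
  have "inj_on (\<lambda>k. a + d * real_of_int k) K" using assms(2) by (auto simp: inj_on_def)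
  hence "card K = n" using assms(1,5) card_image by metis
  then obtain xs where "xs \<in> set (ksets n M)" "set xs = K"
    using ksets_cover[OF assms(3,4)] by blast
  thus ?thesis using assms(1,2) unfolding in_ap_def by blast
qed

lemma card_plus_ap:
  fixes xs :: "int list"
  assumes "A = (\<lambda>k. a + d * real_of_int k) ` set xs" "0 < d"
  shows "card (A + A) = sum_count xs"
proof -
  have A: "A = set (map (\<lambda>k. a + d * real_of_int k) xs)" using assms by simp
  have "A + A = set (map (\<lambda>s. 2 * a + d * real_of_int s) (map_upairs (+) xs))"
    unfolding A set_plus_eq map_upairs_map map_map_upairs
    by (simp add: algebra_simps)
  hence "A + A = (\<lambda>s. 2 * a + d * real_of_int s) ` set (map_upairs (+) xs)" by simp
  moreover have "inj_on (\<lambda>s. 2 * a + d * real_of_int s) (set (map_upairs (+) xs))"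
    using assms(2) by (auto simp: inj_on_def)
  ultimately show ?thesis by (simp add: card_image sum_count_def length_remdups_card_conv)
qed

lemma uminus_sumset: "uminus ` A + uminus ` A = uminus ` (A + A)" for A :: "real set"
proof (intro subset_antisym subsetI)
  fix x assume "x \<in> uminus ` A + uminus ` A"
  then obtain u v where "u \<in> A" "v \<in> A" "x = - u + - v" by (elim set_plus_elim imageE) simp
  thus "x \<in> uminus ` (A + A)" by (intro image_eqI[of _ _ "u + v"] set_plus_intro) auto
next
  fix x assume "x \<in> uminus ` (A + A)"
  then obtain u v where "u \<in> A" "v \<in> A" "x = - u + - v" by (elim set_plus_elim imageE) simp
  thus "x \<in> uminus ` A + uminus ` A" using set_plus_intro[of "- u" "uminus ` A" "- v" "uminus ` A"] by simp
qed

lemma card_uminus: "card (uminus ` A) = card A" for A :: "real set"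
  by (rule card_image) (auto simp: inj_on_def)

text \<open>Reflecting the indices to \<open>m - k\<close>, with \<open>m\<close> the largest one,
  keeps 0 among them and keeps them below \<open>M\<close>. Statements about the maximum thus
  transfer to the minimum.\<close>

lemma in_ap_uminus:
  assumes "in_ap n M A" "0 < n" "0 \<le> M"
  shows "in_ap n M (uminus ` A)"
proof -
  obtain a d xs where h: "0 < d" "xs \<in> set (ksets n M)" "A = (\<lambda>k. a + d * of_int k) ` set xs"
    using assms(1) unfolding in_ap_def by blast
  note k = ksetsD[OF h(2) assms(2)]
  define m where "m = Max (set xs)"
  have m: "m \<in> set xs" "\<And>k. k \<in> set xs \<Longrightarrow> k \<le> m"
    using k(3) unfolding m_def by (auto intro!: Max_in)
  have "m \<le> M" using m(1) k(4) assms(3) by auto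
  show ?thesis
  proof (rule in_apI[where a = "- a - d * of_int m" and d = d and K = "(\<lambda>k. m - k) ` set xs"])
    show "uminus ` A = (\<lambda>k. - a - d * of_int m + d * of_int k) ` (\<lambda>k. m - k) ` set xs"
      unfolding h(3) by (simp add: image_image algebra_simps)
    show "(\<lambda>k. m - k) ` set xs \<subseteq> {0..M}" using m(2) k(4) \<open>m \<le> M\<close> by force
    show "0 \<in> (\<lambda>k. m - k) ` set xs" using m(1) by force
    have "inj_on (\<lambda>k. a + d * real_of_int k) (set xs)" using h(1) by (auto simp: inj_on_def)
    moreover have "distinct xs" using k(1) strict_sorted_iff by blast
    ultimately show "card (uminus ` A) = n" unfolding card_uminus h(3) using k(2)
      by (simp add: card_image distinct_card)
  qed (use h in auto)
qed

section \<open>Adjoining an extreme element\<close>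

lemma top_gaps:
  fixes b p q s :: real
  assumes "A' \<subseteq> {..s} \<union> {q, p}" "s < q" "q < p" "p < b"
  shows "b + q \<in> A' + A' \<Longrightarrow> b + q = 2 * p"
    and "b + q = 2 * p \<Longrightarrow> b + s \<in> A' + A' \<Longrightarrow> b + s = p + q \<or> b + s = 2 * q"
proof -
  have A': "u = p \<or> u = q \<or> u \<le> s" if "u \<in> A'" for u using assms(1) that by auto
  show "b + q = 2 * p" if "b + q \<in> A' + A'"
  proof -
    obtain u v where uv: "u \<in> A'" "v \<in> A'" "b + q = u + v" using \<open>b + q \<in> A' + A'\<close> by (elim set_plus_elim)
    \<comment> \<open>Every sum of two elements of \<open>A'\<close> other than \<open>p + p\<close>
      is at most \<open>p + q\<close>, hence below \<open>b + q\<close>.\<close>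
    show ?thesis using A'[OF uv(1)] A'[OF uv(2)] uv(3) assms(2-4) by (elim disjE) linarith+
  qed
  show "b + s = p + q \<or> b + s = 2 * q" if "b + q = 2 * p" "b + s \<in> A' + A'"
  proof -
    obtain u v where uv: "u \<in> A'" "v \<in> A'" "b + s = u + v" using \<open>b + s \<in> A' + A'\<close> by (elim set_plus_elim)
    \<comment> \<open>A summand \<open>\<le> s\<close> would give at most
      \<open>p + s < b + s\<close>, and \<open>2 * p = b + q\<close> is too large.\<close>
    show ?thesis using A'[OF uv(1)] A'[OF uv(2)] uv(3) assms(2-4) that(1) by (elim disjE) linarith+
  qed
qed

(* Adjoining a new maximum b: if some b + y lies in A' + A', then b is an element of the
   progression with index k at most 2 M'. *)
definition ap_step_ok :: "nat \<Rightarrow> int \<Rightarrow> int \<Rightarrow> bool" where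
  "ap_step_ok n M M' \<longleftrightarrow> (\<forall>xs \<in> set (ksets (n - 1) M'). 2 * n - 3 \<le> sum_count xs \<and>
      (\<forall>k \<in> set [1..2*M']. k \<notin> set xs \<longrightarrow> sum_count (k # xs) \<le> 3 * n - 4 \<longrightarrow> k \<le> M))"

text \<open>The parameters are \<open>M = 2 n - 4\<close> and \<open>M' = 2 (n - 1) - 4\<close>,
  matching Freiman's bound for \<open>n\<close> and for \<open>n - 1\<close> elements.\<close>

lemma ap_step_ok4: "ap_step_ok 4 4 2" and ap_step_ok5: "ap_step_ok 5 6 4"
  and ap_step_ok6: "ap_step_ok 6 8 6"
  by code_simp+

text \<open>Too few sums force \<open>b + y = u + v\<close> with \<open>y\<close>, \<open>u\<close>,
  \<open>v\<close> among the other elements, which places \<open>b\<close> on their progression; the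
  finite check then bounds its index by \<open>M\<close>.\<close>

lemma ap_extend:
  fixes A :: "real set"
  assumes fin: "finite A" "card A = n" and small: "card (A + A) \<le> 3 * n - 4" and n: "2 \<le> n"
    and b: "b \<in> A" "\<And>x. x \<in> A \<Longrightarrow> x \<le> b"
    and ap: "in_ap (n - 1) M' (A - {b})" and ok: "ap_step_ok n M M'" "0 \<le> M'" "M' \<le> M"
  shows "in_ap n M A"
proof -
  define A' where "A' = A - {b}"
  have A: "A = insert b A'" and less: "\<And>x. x \<in> A' \<Longrightarrow> x < b"
    using b unfolding A'_def by (auto simp: order_less_le)
  obtain a d xs where h: "0 < d" "xs \<in> set (ksets (n - 1) M')" "A' = (\<lambda>k. a + d * of_int k) ` set xs"
    using ap unfolding in_ap_def A'_def by blast
  have "0 < n - 1" using n by simp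
  note k = ksetsD[OF h(2) this]
  have range: "0 \<le> k" "k \<le> M'" if "k \<in> set xs" for k using k(4) ok(2) that by auto
  \<comment> \<open>\<open>A'\<close> has at least \<open>2 (n - 1) - 1\<close> sums, and there are
    \<open>n\<close> sums \<open>b + y\<close>. Were the two families disjoint, \<open>A + A\<close>
    would have at least \<open>3 n - 3\<close> elements.\<close>
  have "2 * n - 3 \<le> card (A' + A')"
    using ok(1) h(2) unfolding ap_step_ok_def card_plus_ap[OF h(3,1)] by blast
  moreover have "card ((+) b ` A) = n" using fin by (simp add: card_image)
  moreover have "card (A + A) \<ge> card ((A' + A') \<union> (+) b ` A)"
    by (rule card_mono) (use fin b in \<open>auto simp: finite_set_plus A'_def intro: set_plus_intro set_plus_mono2[THEN subsetD, rotated 2]\<close>)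
  moreover have "finite A'" using fin unfolding A'_def by simp
  ultimately have "(A' + A') \<inter> (+) b ` A \<noteq> {}"
    using small n fin card_Un_disjoint[of "A' + A'" "(+) b ` A"] by (auto simp: finite_set_plus)
  then obtain y where "y \<in> A" "b + y \<in> A' + A'" by auto
  then obtain u v where y: "y \<in> A" "u \<in> A'" "v \<in> A'" "b + y = u + v"
    by (elim set_plus_elim)
  \<comment> \<open>\<open>b + b\<close> exceeds every sum of two elements of \<open>A'\<close>, so
    \<open>y\<close> is not \<open>b\<close>.\<close>
  have "y \<in> A'" using y less[OF y(2)] less[OF y(3)] unfolding A by auto
  then obtain ku kv ky where z: "ku \<in> set xs" "kv \<in> set xs" "ky \<in> set xs"
    "u = a + d * of_int ku" "v = a + d * of_int kv" "y = a + d * of_int ky"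
    using y h(3) by blast
  define m where "m = ku + kv - ky"
  have bm: "b = a + d * of_int m" using y(4) z(4-6) unfolding m_def by (simp add: algebra_simps)
  have "a \<in> A'" using h(3) k(3) by force
  hence "0 < d * of_int m" using less bm by force
  hence m0: "0 < m" using h(1) by (simp add: zero_less_mult_iff)
  have "m \<le> 2 * M'" using range z(1-3) unfolding m_def by (smt (verit))
  have "m \<notin> set xs" using less h(3) bm by force
  have Am: "A = (\<lambda>k. a + d * of_int k) ` set (m # xs)" using A h(3) bm by simp
  have "sum_count (m # xs) \<le> 3 * n - 4" using card_plus_ap[OF Am h(1)] small by simp
  hence "m \<le> M" using ok(1) h(2) m0 \<open>m \<le> 2 * M'\<close> \<open>m \<notin> set xs\<close> unfolding ap_step_ok_def by simp
  thus ?thesis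
    using in_apI[OF Am h(1) _ _ fin(2), of M] k(3) range m0 ok(3) by force
qed

text \<open>\<open>b + b\<close> and \<open>b + p\<close> exceed \<open>2 * p\<close>, the largest
  sum of \<open>A'\<close>, so two new sums exist already; \<open>b + y\<close> outside
  \<open>A' + A'\<close> would be a third.\<close>

lemma new_sums_at_top:
  fixes A :: "real set"
  assumes fin: "finite A" and small: "card (A + A) \<le> card (A' + A') + 2"
    and A: "A = insert b A'" and p: "p \<in> A'" "p < b" "\<And>x. x \<in> A' \<Longrightarrow> x \<le> p"
    and y: "y \<in> A'" "y < p"
  shows "b + y \<in> A' + A'"
proof (rule ccontr)
  assume neg: "b + y \<notin> A' + A'"
  have le: "x \<le> 2 * p" if "x \<in> A' + A'" for x
    using that p(3) by (auto elim!: set_plus_elim) (smt (verit))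
  have "finite A'" using fin A by simp
  moreover have "(A' + A') \<inter> {b + b, b + p, b + y} = {}"
    using neg le[of "b + b"] le[of "b + p"] p(2) by auto
  moreover have "card {b + b, b + p, b + y} = 3" using p(2) y(2) by simp
  ultimately have "card ((A' + A') \<union> {b + b, b + p, b + y}) = card (A' + A') + 3"
    using card_Un_disjoint[of "A' + A'" "{b + b, b + p, b + y}"] by (simp only: finite_set_plus finite.intros)
  moreover have "(A' + A') \<union> {b + b, b + p, b + y} \<subseteq> A + A"
    using p(1) y(1) unfolding A set_plus_def by blast
  ultimately show False
    using small card_mono[of "A + A" "(A' + A') \<union> {b + b, b + p, b + y}"] fin by (simp add: finite_set_plus)
qed

text \<open>
  Removing the maximum \<open>b\<close> either leaves a set to which the induction hypothesis applies or loses only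
  the sums \<open>b + b\<close> and \<open>b + p\<close>; in the second case the gaps next to \<open>b\<close> are almost determined. The
  same at the minimum leaves only finitely many shapes.
\<close>

lemma ap_or_rigid_top:
  fixes A :: "real set"
  assumes IH: "\<And>B :: real set. finite B \<Longrightarrow> card B = n - 1 \<Longrightarrow> card (B + B) \<le> 3 * n - 7 \<Longrightarrow> in_ap (n - 1) M' B"
    and fin: "finite A" "card A = n" and small: "card (A + A) \<le> 3 * n - 4"
    and ok: "ap_step_ok n M M'" "0 \<le> M'" "M' \<le> M"
    and A: "A \<subseteq> {..s} \<union> {q, p, b}" "{s, q, p, b} \<subseteq> A" "s < q" "q < p" "p < b"
  shows "in_ap n M A \<or> b + q = 2 * p \<and> (b + s = p + q \<or> b + s = 2 * q)"
proof -
  define A' where "A' = A - {b}"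
  have "card {s, q, p, b} \<le> n" using A fin card_mono by metis
  hence n: "4 \<le> n" using A(3-5) by simp
  have A': "A' \<subseteq> {..s} \<union> {q, p}" "{s, q, p} \<subseteq> A'" "finite A'" "card A' = n - 1"
    using A fin unfolding A'_def by auto
  show ?thesis
  \<comment> \<open>\<open>3 n - 7 = 3 (n - 1) - 4\<close> is the bound of the induction hypothesis.
    If it fails, \<open>A' + A'\<close> has at least \<open>3 n - 6\<close> elements, so adjoining
    \<open>b\<close> creates at most two sums.\<close>
  proof (cases "card (A' + A') \<le> 3 * n - 7")
    case True
    have "in_ap n M A"
      by (rule ap_extend[OF fin small _ _ _ _ ok, of b])
        (use n A IH[OF A'(3,4) True] in \<open>auto simp: A'_def\<close>)
    thus ?thesis ..
  next
    case False
    have "b + y \<in> A' + A'" if "y \<in> A'" "y < p" for y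
      by (rule new_sums_at_top[where A = A and p = p])
        (use fin small False n A A' that in \<open>auto simp: A'_def\<close>)
    hence "b + q \<in> A' + A'" "b + s \<in> A' + A'" using A' A by auto
    thus ?thesis using top_gaps[OF A'(1) A(3-5)] by blast
  qed
qed

text \<open>The reflection \<open>x \<mapsto> - x\<close> turns the minimum into the maximum and
  preserves the gap equations.\<close>

lemma ap_or_rigid_bot:
  fixes A :: "real set"
  assumes IH: "\<And>B :: real set. finite B \<Longrightarrow> card B = n - 1 \<Longrightarrow> card (B + B) \<le> 3 * n - 7 \<Longrightarrow> in_ap (n - 1) M' B"
    and fin: "finite A" "card A = n" and small: "card (A + A) \<le> 3 * n - 4"
    and ok: "ap_step_ok n M M'" "0 \<le> M'" "M' \<le> M"
    and A: "A \<subseteq> {s..} \<union> {q, p, b}" "{s, q, p, b} \<subseteq> A" "b < p" "p < q" "q < s"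
  shows "in_ap n M A \<or> b + q = 2 * p \<and> (b + s = p + q \<or> b + s = 2 * q)"
proof -
  have "card {s, q, p, b} \<le> n" using A fin card_mono by metis
  hence n: "0 < n" using A(3-5) by simp
  have "in_ap n M (uminus ` A) \<or> - b + - q = 2 * - p \<and> (- b + - s = - p + - q \<or> - b + - s = 2 * - q)"
    by (rule ap_or_rigid_top[OF IH _ _ _ ok])
      (use fin small A in \<open>auto simp: uminus_sumset card_uminus\<close>)
  thus ?thesis
  proof
    assume "in_ap n M (uminus ` A)"
    from in_ap_uminus[OF this n] ok(2,3) have "in_ap n M A" by (simp add: image_image)
    thus ?thesis ..
  qed linarith
qed

section \<open>Freiman's theorem for three to six real numbers\<close>

lemma sorted_enum:
  fixes A :: "real set"
  assumes "finite A" "card A = n"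
  obtains xs where "A = set xs" "sorted_wrt (<) xs" "length xs = n"
  using that[of "sorted_list_of_set A"] assms by simp

text \<open>Unless \<open>a + c = 2 * b\<close>, the six sums of \<open>a < b < c\<close> are
  distinct, one more than allowed.\<close>

lemma in_ap3:
  fixes A :: "real set"
  assumes fin: "finite A" "card A = 3" and small: "card (A + A) \<le> 5"
  shows "in_ap 3 2 A"
proof -
  obtain xs where xs: "A = set xs" "sorted_wrt (<) xs" "length xs = 3" using sorted_enum[OF fin] .
  then obtain a b c where abc: "xs = [a, b, c]" by (auto simp: numeral_eq_Suc length_Suc_conv)
  have A: "A = {a, b, c}" "a < b" "b < c" using xs abc by auto
  have "a + c = 2 * b"
  proof (rule ccontr)
    assume "a + c \<noteq> 2 * b"
    hence "distinct [a + a, a + b, b + b, b + c, c + c, a + c]" using A(2,3) by simp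
    hence "card (set [a + a, a + b, b + b, b + c, c + c, a + c]) = 6" by (simp only: distinct_card) simp
    moreover have "set [a + a, a + b, b + b, b + c, c + c, a + c] \<subseteq> A + A"
      using set_plus_intro[of _ A _ A] unfolding A(1) by (simp only: list.set insert_subset empty_subsetI insert_iff simp_thms)
    moreover have "finite (A + A)" using fin by (simp add: finite_set_plus)
    ultimately show False using small card_mono[of "A + A" "set [a + a, a + b, b + b, b + c, c + c, a + c]"] by linarith
  qed
  hence "A = (\<lambda>k. a + (b - a) * of_int k) ` {0, 1, 2}" unfolding A by (auto simp: algebra_simps)
  thus ?thesis by (rule in_apI) (use A fin in auto)
qed

lemma in_ap4:
  fixes A :: "real set"
  assumes fin: "finite A" "card A = 4" and small: "card (A + A) \<le> 8"
  shows "in_ap 4 4 A"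
proof -
  obtain xs where xs: "A = set xs" "sorted_wrt (<) xs" "length xs = 4" using sorted_enum[OF fin] .
  then obtain a b c d where abc: "xs = [a, b, c, d]" by (auto simp: numeral_eq_Suc length_Suc_conv)
  have A: "A = {a, b, c, d}" "a < b" "b < c" "c < d" using xs abc by auto
  have IH: "in_ap (4 - 1) 2 B" if "finite B" "card B = 4 - 1" "card (B + B) \<le> 3 * 4 - 7" for B :: "real set"
    using in_ap3[of B] that by simp
  have "in_ap 4 4 A \<or> d + b = 2 * c \<and> (d + a = c + b \<or> d + a = 2 * b)"
    by (rule ap_or_rigid_top[OF IH fin _ ap_step_ok4]) (use small A in auto)
  moreover have "in_ap 4 4 A \<or> a + c = 2 * b \<and> (a + d = b + c \<or> a + d = 2 * c)"
    by (rule ap_or_rigid_bot[OF IH fin _ ap_step_ok4]) (use small A in auto)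
  \<comment> \<open>The two equations make all three gaps equal.\<close>
  moreover have "in_ap 4 4 A" if "d + b = 2 * c" "a + c = 2 * b"
  proof (rule in_apI)
    have "c = a + (b - a) * 2" "d = a + (b - a) * 3" using that by auto
    thus "A = (\<lambda>k. a + (b - a) * of_int k) ` {0, 1, 2, 3}" unfolding A by (auto simp: algebra_simps)
  qed (use A fin in auto)
  ultimately show ?thesis by blast
qed

lemma in_ap5:
  fixes A :: "real set"
  assumes fin: "finite A" "card A = 5" and small: "card (A + A) \<le> 11"
  shows "in_ap 5 6 A"
proof -
  obtain xs where xs: "A = set xs" "sorted_wrt (<) xs" "length xs = 5" using sorted_enum[OF fin] .
  then obtain a b c d e where abc: "xs = [a, b, c, d, e]" by (auto simp: numeral_eq_Suc length_Suc_conv)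
  have A: "A = {a, b, c, d, e}" "a < b" "b < c" "c < d" "d < e" using xs abc by auto
  have IH: "in_ap (5 - 1) 4 B" if "finite B" "card B = 5 - 1" "card (B + B) \<le> 3 * 5 - 7" for B :: "real set"
    using in_ap4[of B] that by simp
  have "in_ap 5 6 A \<or> e + c = 2 * d \<and> (e + b = d + c \<or> e + b = 2 * c)"
    by (rule ap_or_rigid_top[OF IH fin _ ap_step_ok5]) (use small A in auto)
  moreover have "in_ap 5 6 A \<or> a + c = 2 * b \<and> (a + d = b + c \<or> a + d = 2 * c)"
    by (rule ap_or_rigid_bot[OF IH fin _ ap_step_ok5]) (use small A in auto)
  \<comment> \<open>The gaps are \<open>g, g, h, h\<close>. The alternatives at the top are
    \<open>h = g\<close> or \<open>2 h = g\<close>, at the bottom \<open>h = g\<close> or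
    \<open>h = 2 g\<close>; with positive gaps only \<open>h = g\<close> meets both.\<close>
  moreover have "in_ap 5 6 A" if "e + c = 2 * d" "e + b = d + c \<or> e + b = 2 * c"
    "a + c = 2 * b" "a + d = b + c \<or> a + d = 2 * c"
  proof (rule in_apI)
    have "c = a + (b - a) * 2" "d = a + (b - a) * 3" "e = a + (b - a) * 4"
      using that A(2-5) by (elim disjE; argo)+
    thus "A = (\<lambda>k. a + (b - a) * of_int k) ` {0, 1, 2, 3, 4}" unfolding A by (auto simp: algebra_simps)
  qed (use A fin in auto)
  ultimately show ?thesis by blast
qed

lemma in_ap6:
  fixes A :: "real set"
  assumes fin: "finite A" "card A = 6" and small: "card (A + A) \<le> 14"
  shows "in_ap 6 8 A"
proof -
  obtain xs where xs: "A = set xs" "sorted_wrt (<) xs" "length xs = 6" using sorted_enum[OF fin] .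
  then obtain a b c d e f where abc: "xs = [a, b, c, d, e, f]" by (auto simp: numeral_eq_Suc length_Suc_conv)
  have A: "A = {a, b, c, d, e, f}" "a < b" "b < c" "c < d" "d < e" "e < f" using xs abc by auto
  have IH: "in_ap (6 - 1) 6 B" if "finite B" "card B = 6 - 1" "card (B + B) \<le> 3 * 6 - 7" for B :: "real set"
    using in_ap5[of B] that by simp
  have "in_ap 6 8 A \<or> f + d = 2 * e \<and> (f + c = e + d \<or> f + c = 2 * d)"
    by (rule ap_or_rigid_top[OF IH fin _ ap_step_ok6]) (use small A in auto)
  moreover have "in_ap 6 8 A \<or> a + c = 2 * b \<and> (a + d = b + c \<or> a + d = 2 * c)"
    by (rule ap_or_rigid_bot[OF IH fin _ ap_step_ok6]) (use small A in auto)
  moreover have "in_ap 6 8 A" if h: "f + d = 2 * e" "f + c = e + d \<or> f + c = 2 * d"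
    "a + c = 2 * b" "a + d = b + c \<or> a + d = 2 * c"
  proof -
    have ap: "in_ap 6 8 A" if "A = (\<lambda>k. a + w * of_int k) ` K" "0 < w" "K \<subseteq> {0..8}" "0 \<in> K" for w K
      using in_apI[OF that] fin by simp
    \<comment> \<open>The gaps are \<open>g, g, w, h, h\<close> with \<open>w\<close> equal to
      \<open>h\<close> or \<open>2 h\<close>, and to \<open>g\<close> or \<open>2 g\<close>. The
      cases have gap patterns \<open>1,1,1,1,1\<close>, then \<open>1,1,2,2,2\<close>, then
      \<open>2,2,2,1,1\<close> (unit \<open>f - e\<close>), then \<open>1,1,2,1,1\<close>.\<close>
    consider "f + c = e + d" "a + d = b + c" | "f + c = e + d" "a + d = 2 * c"
      | "f + c = 2 * d" "a + d = b + c" | "f + c = 2 * d" "a + d = 2 * c" using h by blast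
    thus ?thesis
    proof cases
      case 1
      hence "c = a + (b - a) * 2" "d = a + (b - a) * 3" "e = a + (b - a) * 4" "f = a + (b - a) * 5"
        using h(1,3) by argo+
      hence "A = (\<lambda>k. a + (b - a) * of_int k) ` {0, 1, 2, 3, 4, 5}" unfolding A by (auto simp: algebra_simps)
      thus ?thesis by (rule ap) (use A in auto)
    next
      case 2
      hence "c = a + (b - a) * 2" "d = a + (b - a) * 4" "e = a + (b - a) * 6" "f = a + (b - a) * 8"
        using h(1,3) by argo+
      hence "A = (\<lambda>k. a + (b - a) * of_int k) ` {0, 1, 2, 4, 6, 8}" unfolding A by (auto simp: algebra_simps)
      thus ?thesis by (rule ap) (use A in auto)
    next
      case 3
      hence "b = a + (f - e) * 2" "c = a + (f - e) * 4" "d = a + (f - e) * 6" "e = a + (f - e) * 7" "f = a + (f - e) * 8"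
        using h(1,3) by argo+
      hence "A = (\<lambda>k. a + (f - e) * of_int k) ` {0, 2, 4, 6, 7, 8}" unfolding A by (auto simp: algebra_simps)
      thus ?thesis by (rule ap) (use A in auto)
    next
      case 4
      hence "c = a + (b - a) * 2" "d = a + (b - a) * 4" "e = a + (b - a) * 5" "f = a + (b - a) * 6"
        using h(1,3) by argo+
      hence "A = (\<lambda>k. a + (b - a) * of_int k) ` {0, 1, 2, 4, 5, 6}" unfolding A by (auto simp: algebra_simps)
      thus ?thesis by (rule ap) (use A in auto)
    qed
  qed
  ultimately show ?thesis by blast
qed

section \<open>Products of shifted integers\<close>

text \<open>For \<open>x = N / D\<close> the factors are \<open>D (x + k)\<close>, so the products
  \<open>(x + k) (x + l)\<close> are compared in integer arithmetic.\<close>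

definition prod_count :: "int \<Rightarrow> int \<Rightarrow> int list \<Rightarrow> nat" where
  "prod_count N D xs = length (remdups (map_upairs (*) (map (\<lambda>k. N + D * k) xs)))"

(* The functions evaluated below use nested conditionals because code_simp rewrites both sides of a
   conjunction but only the condition of a conditional. *)
fun cons_if_pos :: "int \<Rightarrow> int \<Rightarrow> (int \<times> int) list \<Rightarrow> (int \<times> int) list" where
  "cons_if_pos N D cs = (if 0 < D then if 0 < N then List.insert (N, D) cs else cs else cs)"

fun collisions_with :: "int \<Rightarrow> int \<Rightarrow> (int \<times> int) list \<Rightarrow> (int \<times> int) list \<Rightarrow> (int \<times> int) list" where
  "collisions_with k l [] cs = cs"
| "collisions_with k l ((m, n) # qs) cs =
    collisions_with k l qs (cons_if_pos (m * n - k * l) (k + l - m - n) cs)"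

fun collisions_from :: "(int \<times> int) list \<Rightarrow> (int \<times> int) list \<Rightarrow> (int \<times> int) list" where
  "collisions_from [] qs = []"
| "collisions_from ((k, l) # ps) qs = collisions_with k l qs (collisions_from ps qs)"

(* All (N, D) such that x = N / D > 0 makes two different products (x + k) * (x + l) equal. *)
definition collisions :: "int list \<Rightarrow> (int \<times> int) list" where
  "collisions xs = collisions_from (map_upairs Pair xs) (map_upairs Pair xs)"

lemma set_collisions_with:
  "set (collisions_with k l qs cs) =
    set cs \<union> {(m * n - k * l, k + l - m - n) | m n. (m, n) \<in> set qs \<and> 0 < m * n - k * l \<and> 0 < k + l - m - n}"
  by (induction k l qs cs rule: collisions_with.induct) auto

lemma collisions_fromI:
  assumes "(k, l) \<in> set ps" "(m, n) \<in> set qs" "0 < m * n - k * l" "0 < k + l - m - n"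
  shows "(m * n - k * l, k + l - m - n) \<in> set (collisions_from ps qs)"
  using assms by (induction ps qs rule: collisions_from.induct) (auto simp: set_collisions_with)

lemma length_map_upairs: "length (map_upairs f xs) = length xs * (length xs + 1) div 2"
  by (induction xs) auto

lemma set_upairs_sorted:
  "(k, l) \<in> set (map_upairs Pair xs) \<longleftrightarrow> k \<in> set xs \<and> l \<in> set xs \<and> k \<le> l"
  if "sorted_wrt (<) xs" for xs :: "'a::linorder list"
  using that by (induction xs) (auto simp: order.strict_implies_order)

lemma distinct_upairs: "distinct xs \<Longrightarrow> distinct (map_upairs Pair xs)"
proof (induction xs)
  case (Cons x xs)
  have "set (map_upairs Pair xs) \<subseteq> set xs \<times> set xs"
    by (induction xs) auto
  with Cons show ?case by (auto simp: distinct_map inj_on_def)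
qed simp

lemma map_upairs_conv: "map_upairs f xs = map (\<lambda>(k, l). f k l) (map_upairs Pair xs)"
  by (simp add: map_map_upairs)

text \<open>By Vieta, \<open>k\<close> is a root of \<open>(t - m) (t - n)\<close>.\<close>

lemma pair_eqI_sum_prod:
  fixes k l m n :: int
  assumes "k \<le> l" "m \<le> n" "k + l = m + n" "k * l = m * n"
  shows "k = m \<and> l = n"
proof -
  have "(k - m) * (k - n) = k * k - (m + n) * k + m * n" by (simp add: algebra_simps)
  also have "\<dots> = 0" unfolding assms(3)[symmetric] assms(4)[symmetric] by (simp add: algebra_simps)
  finally have "k = m \<or> k = n" by simp
  thus ?thesis using assms by auto
qed

text \<open>An equality of two products is linear in \<open>x\<close>. Its coefficient, the
  difference of the index sums, cannot vanish: otherwise the index products would agree too, and the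
  two pairs would coincide.\<close>

lemma collision_obtain:
  fixes x :: real
  assumes x: "0 < x" and xs: "sorted_wrt (<) xs"
    and col: "p \<in> set (map_upairs Pair xs)" "q \<in> set (map_upairs Pair xs)" "p \<noteq> q"
      "(x + of_int (fst p)) * (x + of_int (snd p)) = (x + of_int (fst q)) * (x + of_int (snd q))"
  obtains N D where "(N, D) \<in> set (collisions xs)" "0 < D" "x = of_int N / of_int D"
proof -
  note goal = that
  have key: thesis if pq: "p \<in> set (map_upairs Pair xs)" "q \<in> set (map_upairs Pair xs)"
      "(x + of_int (fst p)) * (x + of_int (snd p)) = (x + of_int (fst q)) * (x + of_int (snd q))"
      "fst q + snd q < fst p + snd p" for p q
  proof -
    define N D where "N = fst q * snd q - fst p * snd p" and "D = fst p + snd p - fst q - snd q"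
    have D: "0 < D" using pq(4) unfolding D_def by simp
    have eq: "x * of_int D = of_int N" using pq(3) unfolding N_def D_def by (simp add: algebra_simps)
    hence "0 < N" using mult_pos_pos[of x "of_int D"] x D by simp
    hence "(N, D) \<in> set (collisions xs)"
      using D pq(1,2) unfolding collisions_def N_def D_def by (intro collisions_fromI) simp_all
    moreover have "x = of_int N / of_int D" using eq D by (simp add: field_simps)
    ultimately show thesis using goal D by blast
  qed
  have "fst p + snd p \<noteq> fst q + snd q"
  proof
    assume s: "fst p + snd p = fst q + snd q"
    have "real_of_int (fst p * snd p) - of_int (fst q * snd q)
        = x * (of_int (fst q + snd q) - of_int (fst p + snd p))"
      using col(4) by (simp add: algebra_simps)
    hence "real_of_int (fst p * snd p) = of_int (fst q * snd q)" using s by simp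
    hence "fst p * snd p = fst q * snd q" unfolding of_int_eq_iff .
    moreover have "fst p \<le> snd p" "fst q \<le> snd q"
      using col(1,2) set_upairs_sorted[OF xs, of "fst p" "snd p"] set_upairs_sorted[OF xs, of "fst q" "snd q"] by simp_all
    ultimately have "fst p = fst q \<and> snd p = snd q" using s by (intro pair_eqI_sum_prod)
    thus False using col(3) by (simp add: prod_eq_iff)
  qed
  thus thesis using key[of p q] key[of q p] col by linarith
qed

text \<open>A single coincidence already determines \<open>x\<close> as a listed fraction
  \<open>N / D\<close>; scaling all products by \<open>D^2\<close> then makes their number
  computable.\<close>

lemma card_prods_shift:
  fixes x :: real
  assumes "0 < x" "sorted_wrt (<) xs"
  shows "card (set (map_upairs (\<lambda>k l. (x + of_int k) * (x + of_int l)) xs)) = length xs * (length xs + 1) div 2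
    \<or> (\<exists>(N, D) \<in> set (collisions xs).
        card (set (map_upairs (\<lambda>k l. (x + of_int k) * (x + of_int l)) xs)) = prod_count N D xs)"
proof -
  define g where "g p = (x + of_int (fst p)) * (x + of_int (snd p))" for p
  let ?P = "map_upairs Pair xs"
  have eq: "map_upairs (\<lambda>k l. (x + of_int k) * (x + of_int l)) xs = map g ?P"
    unfolding g_def by (simp add: map_map_upairs)
  have dP: "distinct ?P" using assms(2) distinct_upairs strict_sorted_iff by blast
  show ?thesis
  proof (cases "inj_on g (set ?P)")
    case True
    hence "card (set (map g ?P)) = length ?P" using dP by (simp add: card_image distinct_card)
    thus ?thesis unfolding eq by (simp add: length_map_upairs)
  next
    case False
    then obtain p q where "p \<in> set ?P" "q \<in> set ?P" "p \<noteq> q" "g p = g q" unfolding inj_on_def by blast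
    then obtain N D where ND: "(N, D) \<in> set (collisions xs)" "0 < D" "x = of_int N / of_int D"
      using collision_obtain[OF assms, of p q] unfolding g_def by blast
    define h where "h p = (N + D * fst p) * (N + D * snd p)" for p
    define c where "c z = real_of_int z / (of_int D)\<^sup>2" for z
    have "g p = c (h p)" for p
      using ND(2) unfolding g_def h_def c_def ND(3) by (simp add: field_simps power2_eq_square)
    hence "set (map g ?P) = c ` h ` set ?P" by (simp add: image_image)
    moreover have "inj_on c (h ` set ?P)" using ND(2) unfolding c_def inj_on_def by simp
    ultimately have "card (set (map g ?P)) = card (h ` set ?P)" by (simp only: card_image)
    also have "\<dots> = prod_count N D xs"
      unfolding prod_count_def length_remdups_card_conv h_def map_upairs_map
      by (subst (2) map_upairs_conv) (simp add: case_prod_unfold)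
    finally show ?thesis using ND(1) unfolding eq by blast
  qed
qed

fun prods_in :: "(nat \<times> nat) list \<Rightarrow> nat \<Rightarrow> int list \<Rightarrow> (int \<times> int) list \<Rightarrow> bool" where
  "prods_in S s xs [] = True"
| "prods_in S s xs ((N, D) # cs) = (if (s, prod_count N D xs) \<in> set S then prods_in S s xs cs else False)"

text \<open>A generic shift gives \<open>n (n + 1) / 2\<close> products; the shifts in
  \<open>collisions xs\<close> are tested one by one.\<close>

fun ap_pairs_in :: "nat \<Rightarrow> (nat \<times> nat) list \<Rightarrow> nat \<Rightarrow> int list \<Rightarrow> bool" where
  "ap_pairs_in n S s xs = (if s \<le> 3 * n - 4 then
     if (s, n * (n + 1) div 2) \<in> set S then prods_in S s xs (collisions xs) else False else True)"

definition ap_products_ok :: "nat \<Rightarrow> int \<Rightarrow> (nat \<times> nat) list \<Rightarrow> bool" where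
  "ap_products_ok n M S \<longleftrightarrow> list_all (\<lambda>xs. ap_pairs_in n S (sum_count xs) xs) (ksets n M)"

lemma prods_inD:
  "prods_in S s xs cs \<Longrightarrow> (N, D) \<in> set cs \<Longrightarrow> (s, prod_count N D xs) \<in> set S"
  by (induction S s xs cs rule: prods_in.induct) (auto split: if_splits)

lemma ap_products:
  assumes ap: "in_ap n M A" and pos: "\<And>x. x \<in> A \<Longrightarrow> 0 < x" and ok: "ap_products_ok n M S"
    and n: "0 < n" and small: "card (A + A) \<le> 3 * n - 4"
  shows "(card (A + A), card (A * A)) \<in> set S"
proof -
  obtain a d xs where h: "0 < d" "xs \<in> set (ksets n M)" "A = (\<lambda>k. a + d * of_int k) ` set xs"
    using ap unfolding in_ap_def by blast
  note k = ksetsD[OF h(2) n]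
  \<comment> \<open>Scaling by \<open>d\<close> does not affect the number of products, so only the
    shift \<open>a / d\<close> matters. Index 0 makes \<open>a\<close> an element of
    \<open>A\<close>, whence the shift is positive.\<close>
  define x where "x = a / d"
  have "a \<in> A" using h(3) k(3) by force
  hence x: "0 < x" using pos h(1) unfolding x_def by simp
  have A: "A = set (map (\<lambda>k. d * (x + of_int k)) xs)"
    using h(1,3) unfolding x_def by (auto simp: algebra_simps)
  have "A * A = (*) (d\<^sup>2) ` set (map_upairs (\<lambda>k l. (x + of_int k) * (x + of_int l)) xs)"
    unfolding A set_times_eq map_upairs_map list.set_map[symmetric] map_map_upairs
    by (simp add: algebra_simps power2_eq_square)
  moreover have "inj ((*) (d\<^sup>2))" using h(1) by (simp add: inj_on_def)
  ultimately have "card (A * A) = card (set (map_upairs (\<lambda>k l. (x + of_int k) * (x + of_int l)) xs))"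
    by (metis card_image inj_on_subset subset_UNIV)
  moreover have "card (A + A) = sum_count xs" by (rule card_plus_ap[OF h(3,1)])
  ultimately show ?thesis
    using card_prods_shift[OF x k(1)] ok h(2) small k(2) prods_inD[of S "sum_count xs" xs "collisions xs"]
    unfolding ap_products_ok_def list_all_iff by (fastforce split: if_splits)
qed

text \<open>The list holds the elements of \<open>pairs5\<close> with at most
  \<open>3 * 5 - 4\<close> sums; the next lemma does the same for \<open>pairs6\<close> and
  \<open>3 * 6 - 4\<close>.\<close>

lemma ap_products_ok5: "ap_products_ok 5 6 [(9, 14), (9, 15), (10, 12), (10, 14), (10, 15), (11, 12), (11, 14), (11, 15)]"
  by code_simp

lemma ap_products_ok6: "ap_products_ok 6 8 ([(13, 15), (14, 15), (14, 19), (13, 19)] @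
    List.product [11..<15] [18, 20, 21])"
  by code_simp

section \<open>Roots of the trinomials\<close>

definition is_trinomial_root :: "real \<Rightarrow> int \<Rightarrow> int \<Rightarrow> int \<Rightarrow> bool" where
  "is_trinomial_root r l m n \<longleftrightarrow> 0 < l \<and> l \<le> m \<and> m < n \<and> r powi n + 1 = r powi l + r powi m"

lemma is_trinomial_root_nat:
  assumes "is_trinomial_root r l m n"
  shows "0 < nat l" "nat l \<le> nat m" "nat m < nat n" "r ^ nat n + 1 = r ^ nat l + r ^ nat m"
  using assms unfolding is_trinomial_root_def by (auto simp: power_int_nonneg_exp)

text \<open>\<open>(r^l - 1) (r^m - 1) > 0\<close> means
  \<open>r^(l+m) + 1 > r^l + r^m = r^n + 1\<close>. This limits the triples that the table of roots
  has to cover.\<close>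

lemma trinomial_root_less_sum:
  fixes r :: real
  assumes r: "1 < r" and eq: "r ^ n + 1 = r ^ l + r ^ m" and pos: "0 < l" "0 < m"
  shows "n < l + m"
proof (rule ccontr)
  assume "\<not> n < l + m"
  hence "r ^ (l + m) \<le> r ^ n" using r by (intro power_increasing) auto
  moreover have "0 < (r ^ l - 1) * (r ^ m - 1)" using r pos by (intro mult_pos_pos) (auto simp: one_less_power)
  ultimately show False using eq by (simp add: algebra_simps power_add)
qed

(* After division by (x - 1) * x^l the two sums below are respectively nondecreasing and strictly
   decreasing in x, whence the trinomial changes sign only once above 1. *)
lemma trinomial_factor:
  fixes x :: real
  assumes "m < n"
  shows "x ^ n + 1 - x ^ l - x ^ m = (x - 1) * (x ^ m * (\<Sum>i<n - m. x ^ i) - (\<Sum>i<l. x ^ i))"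
proof -
  have "x ^ n = x ^ m * x ^ (n - m)" using assms by (simp flip: power_add)
  moreover have "x ^ (n - m) = (x - 1) * (\<Sum>i<n - m. x ^ i) + 1" "x ^ l = (x - 1) * (\<Sum>i<l. x ^ i) + 1"
    using power_diff_1_eq[of x "n - m"] power_diff_1_eq[of x l] by linarith+
  ultimately show ?thesis by (simp add: algebra_simps)
qed

lemma trinomial_neg_below:
  fixes x y :: real
  assumes xy: "1 < x" "x < y" and lmn: "0 < l" "l \<le> m" "m < n" and le: "y ^ n + 1 \<le> y ^ l + y ^ m"
  shows "x ^ n + 1 < x ^ l + x ^ m"
proof -
  let ?a = "\<lambda>z. \<Sum>i<n - m. z ^ i :: real" and ?b = "\<lambda>z. \<Sum>i<l. z ^ i :: real"
  have "(y - 1) * (y ^ m * ?a y - ?b y) \<le> 0"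
    unfolding trinomial_factor[OF lmn(3), symmetric] using le by simp
  hence 1: "y ^ m * ?a y \<le> ?b y" using xy by (simp add: mult_le_0_iff)
  \<comment> \<open>Cross-multiplied form of the fact that \<open>?b z / z^l\<close> strictly
    decreases in \<open>z\<close>.\<close>
  have "(\<Sum>i<l. y ^ i * x ^ l) < (\<Sum>i<l. x ^ i * y ^ l)"
  proof (rule sum_strict_mono)
    fix i assume "i \<in> {..<l}"
    hence i: "i < l" by simp
    have "x ^ (l - i) < y ^ (l - i)" using i xy by (intro power_strict_mono) auto
    hence "(x ^ i * y ^ i) * x ^ (l - i) < (x ^ i * y ^ i) * y ^ (l - i)" using xy by simp
    moreover have "x ^ l = x ^ i * x ^ (l - i)" "y ^ l = y ^ i * y ^ (l - i)" using i by (simp_all flip: power_add)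
    ultimately show "y ^ i * x ^ l < x ^ i * y ^ l" by (simp add: algebra_simps)
  qed (use lmn in auto)
  hence 2: "?b y * x ^ l < ?b x * y ^ l" by (simp add: sum_distrib_right)
  \<comment> \<open>The other factor, \<open>z^(m-l) * ?a z\<close>, does not decrease.\<close>
  have "x ^ (m - l) * ?a x \<le> y ^ (m - l) * ?a y"
    using xy by (intro mult_mono power_mono sum_mono sum_nonneg) auto
  hence "(x ^ l * y ^ l) * (x ^ (m - l) * ?a x) \<le> (x ^ l * y ^ l) * (y ^ (m - l) * ?a y)"
    using xy by (intro mult_left_mono) auto
  moreover have "x ^ m = x ^ l * x ^ (m - l)" "y ^ m = y ^ l * y ^ (m - l)" using lmn by (simp_all flip: power_add)
  ultimately have "y ^ l * (x ^ m * ?a x) \<le> x ^ l * (y ^ m * ?a y)" by (simp add: algebra_simps)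
  also have "\<dots> \<le> x ^ l * ?b y" using 1 xy by (intro mult_left_mono) auto
  also have "\<dots> < y ^ l * ?b x" using 2 by (simp add: mult.commute)
  finally have "x ^ m * ?a x < ?b x" using xy by simp
  hence "(x - 1) * (x ^ m * ?a x - ?b x) < 0" using xy by (intro mult_pos_neg) auto
  thus ?thesis using trinomial_factor[OF lmn(3), of x l] by linarith
qed

text \<open>With \<open>r = p / q\<close> in lowest terms and denominators cleared, \<open>q\<close>
  divides \<open>p^n\<close> and \<open>p\<close> divides \<open>q^n\<close>; coprimality leaves
  only \<open>r = 1\<close>.\<close>

lemma rational_no_trinomial_root:
  fixes r :: real
  assumes r: "r \<in> \<rat>" "1 < r" and lmn: "0 < l" "0 < m" "l < n" "m < n" and eq: "r ^ n + 1 = r ^ l + r ^ m"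
  shows False
proof -
  obtain p q :: nat where pq: "q \<noteq> 0" "\<bar>r\<bar> = real p / real q" "coprime p q"
    using Rats_abs_nat_div_natE[OF r(1)] by metis
  hence rpq: "r = real p / real q" using r by simp
  have pw: "r ^ i * real q ^ n = real (p ^ i * q ^ (n - i))" if "i \<le> n" for i
  proof -
    have "real q ^ n = real q ^ i * real q ^ (n - i)" using that by (simp flip: power_add)
    thus ?thesis using pq(1) unfolding rpq by (simp add: power_divide)
  qed
  have "(r ^ n + 1) * real q ^ n = (r ^ l + r ^ m) * real q ^ n" using eq by simp
  hence "real (p ^ n + q ^ n) = real (p ^ l * q ^ (n - l) + p ^ m * q ^ (n - m))"
    using pw[of n] pw[of l] pw[of m] lmn by (simp add: distrib_right)
  hence nat_eq: "p ^ n + q ^ n = p ^ l * q ^ (n - l) + p ^ m * q ^ (n - m)" unfolding of_nat_eq_iff .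
  have "q dvd p ^ l * q ^ (n - l) + p ^ m * q ^ (n - m)" using lmn by (intro dvd_add dvd_mult dvd_power) auto
  moreover have "q dvd q ^ n" using lmn by (intro dvd_power) auto
  ultimately have "q dvd p ^ n" using dvd_add_left_iff[of q "q ^ n" "p ^ n"] nat_eq by simp
  moreover have "coprime (p ^ n) q" using pq(3) by simp
  ultimately have "q = 1" by (metis coprime_common_divisor dvd_refl nat_dvd_1_iff_1)
  have "p dvd p ^ l * q ^ (n - l) + p ^ m * q ^ (n - m)" using lmn by (intro dvd_add dvd_mult2 dvd_power) auto
  moreover have "p dvd p ^ n" using lmn by (intro dvd_power) auto
  ultimately have "p dvd q ^ n" using dvd_add_right_iff[of p "p ^ n" "q ^ n"] nat_eq by simp
  hence "p = 1" using \<open>q = 1\<close> by simp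
  thus False using rpq \<open>q = 1\<close> r(2) by simp
qed

(* The signs at c / 1000, cleared of denominators. *)
fun trinomial_neg :: "int \<Rightarrow> int \<times> int \<times> int \<Rightarrow> bool" where
  "trinomial_neg c (l, m, n) \<longleftrightarrow>
    c ^ nat n + 1000 ^ nat n < c ^ nat l * 1000 ^ nat (n - l) + c ^ nat m * 1000 ^ nat (n - m)"

fun trinomial_pos :: "int \<Rightarrow> int \<times> int \<times> int \<Rightarrow> bool" where
  "trinomial_pos c (l, m, n) \<longleftrightarrow>
    c ^ nat l * 1000 ^ nat (n - l) + c ^ nat m * 1000 ^ nat (n - m) < c ^ nat n + 1000 ^ nat n"

lemma scaled_trinomial:
  assumes "0 < l" "l \<le> m" "m < n"
  shows "real_of_int (c ^ nat n + 1000 ^ nat n) = ((c / 1000) ^ nat n + 1) * 1000 ^ nat n"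
    and "real_of_int (c ^ nat l * 1000 ^ nat (n - l) + c ^ nat m * 1000 ^ nat (n - m)) =
      ((c / 1000) ^ nat l + (c / 1000) ^ nat m) * 1000 ^ nat n"
proof -
  have "(1000 :: real) ^ nat n = 1000 ^ nat i * 1000 ^ nat (n - i)" if "0 \<le> i" "i \<le> n" for i
    using that by (simp flip: power_add add: nat_add_distrib[symmetric])
  hence "real_of_int c ^ nat i * 1000 ^ nat (n - i) = (c / 1000) ^ nat i * 1000 ^ nat n" if "0 \<le> i" "i \<le> n" for i
    using that by (simp add: power_divide)
  from this[of l] this[of m] assms
  show "real_of_int (c ^ nat l * 1000 ^ nat (n - l) + c ^ nat m * 1000 ^ nat (n - m)) =
      ((c / 1000) ^ nat l + (c / 1000) ^ nat m) * 1000 ^ nat n"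
    by (simp add: distrib_right)
qed (simp add: power_divide distrib_right)

lemma trinomial_neg_iff:
  assumes "0 < l" "l \<le> m" "m < n"
  shows "trinomial_neg c (l, m, n) \<longleftrightarrow> (c / 1000) ^ nat n + 1 < (c / 1000) ^ nat l + (c / 1000) ^ nat m"
  unfolding trinomial_neg.simps of_int_less_iff[where 'a = real, symmetric] scaled_trinomial[OF assms] by simp

lemma trinomial_pos_iff:
  assumes "0 < l" "l \<le> m" "m < n"
  shows "trinomial_pos c (l, m, n) \<longleftrightarrow> (c / 1000) ^ nat l + (c / 1000) ^ nat m < (c / 1000) ^ nat n + 1"
  unfolding trinomial_pos.simps of_int_less_iff[where 'a = real, symmetric] scaled_trinomial[OF assms] by simp

text \<open>By \<open>trinomial_neg_below\<close>, a negative value at \<open>c / 1000\<close> makes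
  the trinomial negative on the whole way down to 1, which leaves no room for \<open>r\<close>
  there.\<close>

lemma trinomial_root_gt:
  assumes t: "is_trinomial_root r l m n" and r: "1 < r" and neg: "trinomial_neg c (l, m, n)"
  shows "of_int c / 1000 < r"
proof (rule ccontr)
  assume "\<not> of_int c / 1000 < r"
  hence le: "r \<le> of_int c / 1000" by simp
  note t' = is_trinomial_root_nat[OF t]
  have neg': "(c / 1000) ^ nat n + 1 < (c / 1000) ^ nat l + (c / 1000) ^ nat m"
    using neg t trinomial_neg_iff unfolding is_trinomial_root_def by blast
  show False
  proof (cases "r = c / 1000")
    case False
    with le trinomial_neg_below[OF r _ t'(1-3), of "c / 1000"] neg' t'(4) show False by simp
  next
    case True
    show False using neg' t'(4) unfolding True[symmetric] by simp
  qed
qed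

text \<open>If \<open>r\<close> were larger, the trinomial would be negative at
  \<open>c / 1000\<close>. The bound on \<open>c\<close> keeps this point above the trivial root
  1.\<close>

lemma trinomial_root_less:
  assumes t: "is_trinomial_root r l m n" and pos: "trinomial_pos c (l, m, n)" and c: "1000 < c"
  shows "r < of_int c / 1000"
proof (rule ccontr)
  assume "\<not> r < of_int c / 1000"
  hence le: "of_int c / 1000 \<le> r" by simp
  note t' = is_trinomial_root_nat[OF t]
  have pos': "(c / 1000) ^ nat l + (c / 1000) ^ nat m < (c / 1000) ^ nat n + 1"
    using pos t trinomial_pos_iff unfolding is_trinomial_root_def by blast
  show False
  proof (cases "r = c / 1000")
    case False
    with le trinomial_neg_below[OF _ _ t'(1-3), of "c / 1000" r] pos' t'(4) c show False by simp
  next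
    case True
    show False using pos' t'(4) unfolding True[symmetric] by simp
  qed
qed

(* An entry (lo, hi, ts) says that the trinomials in ts have their root above 1 between lo / 1000 and
   hi / 1000. Only the plastic number, r^3 = r + 1, is a root of more than one of them. *)
definition root_table :: "(int \<times> int \<times> (int \<times> int \<times> int) list) list" where
  "root_table =
    [(1050, 1070, [(4, 5, 8)]),
     (1070, 1080, [(3, 6, 8)]),
     (1080, 1090, [(4, 4, 7)]),
     (1090, 1100, [(3, 5, 7)]),
     (1100, 1120, [(2, 7, 8)]),
     (1120, 1130, [(3, 4, 6)]),
     (1130, 1135, [(2, 6, 7)]),
     (1135, 1150, [(5, 5, 8)]),
     (1150, 1160, [(4, 6, 8)]),
     (1160, 1170, [(2, 5, 6)]),
     (1170, 1190, [(3, 3, 5)]),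
     (1190, 1200, [(4, 5, 7)]),
     (1200, 1210, [(3, 7, 8)]),
     (1210, 1230, [(2, 4, 5)]),
     (1230, 1240, [(5, 6, 8)]),
     (1240, 1260, [(3, 6, 7)]),
     (1260, 1280, [(4, 4, 6)]),
     (1280, 1300, [(4, 7, 8)]),
     (1300, 1340, [(2, 3, 4), (3, 5, 6), (5, 5, 7)]),
     (1340, 1370, [(6, 6, 8)]),
     (1370, 1400, [(4, 6, 7)]),
     (1400, 1440, [(5, 7, 8)]),
     (1440, 1500, [(3, 4, 5)]),
     (1500, 1550, [(4, 5, 6)]),
     (1550, 1580, [(5, 6, 7)]),
     (1580, 1600, [(6, 7, 8)]),
     (1600, 1700, [(2, 2, 3)]),
     (1700, 1900, [(3, 3, 4)]),
     (1900, 1950, [(4, 4, 5)]),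
     (1950, 1970, [(5, 5, 6)]),
     (1970, 1990, [(6, 6, 7)]),
     (1990, 2000, [(7, 7, 8)])]"

text \<open>Neighbouring intervals may share an endpoint, which is harmless because roots lie
  strictly inside.\<close>

fun separated :: "int \<Rightarrow> (int \<times> int \<times> 'a) list \<Rightarrow> bool" where
  "separated c [] \<longleftrightarrow> True"
| "separated c ((lo, hi, x) # es) \<longleftrightarrow> c \<le> lo \<and> lo < hi \<and> separated hi es"

lemma separated_lower: "separated c es \<Longrightarrow> (lo, hi, x) \<in> set es \<Longrightarrow> c \<le> lo \<and> lo < hi"
  by (induction c es rule: separated.induct) fastforce+

lemma separated_disjoint:
  assumes "separated c es" "(lo, hi, x) \<in> set es" "(lo', hi', x') \<in> set es"
    "real_of_int lo < r" "r < of_int hi" "real_of_int lo' < r" "r < of_int hi'"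
  shows "x = x'"
proof -
  show ?thesis using assms
  proof (induction c es rule: separated.induct)
    case (2 c l h y es)
    show ?case
    proof (cases "(lo, hi, x) \<in> set es \<longleftrightarrow> (lo', hi', x') \<in> set es")
      case True
      thus ?thesis using 2 by auto
    next
      case False
      thus ?thesis using 2 separated_lower[of h es lo hi x] separated_lower[of h es lo' hi' x'] by fastforce
    qed
  qed simp
qed

text \<open>The starting value 1001 puts every interval to the right of the trivial root 1.\<close>

lemma root_table_separated: "separated 1001 root_table" by code_simp

lemma root_table_bounds:
  "\<forall>(lo, hi, ts) \<in> set root_table. \<forall>t \<in> set ts. trinomial_neg lo t \<and> trinomial_pos hi t"
  by code_simp

text \<open>The bound 8 is the largest index difference for six elements; \<open>n < l + m\<close>
  comes from \<open>trinomial_root_less_sum\<close>.\<close>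

lemma root_table_complete:
  "\<forall>n \<in> set [2..8]. \<forall>m \<in> set [1..n - 1]. \<forall>l \<in> set [1..m]. n < l + m \<longrightarrow>
     (\<exists>(lo, hi, ts) \<in> set root_table. (l, m, n) \<in> set ts)"
  by code_simp

lemma trinomial_root_entry:
  assumes r: "1 < r" and t: "is_trinomial_root r l m n" "n \<le> 8"
  obtains lo hi ts where "(lo, hi, ts) \<in> set root_table" "(l, m, n) \<in> set ts"
    "of_int lo < 1000 * r" "1000 * r < of_int hi"
proof -
  note t' = is_trinomial_root_nat[OF t(1)]
  have "nat n < nat l + nat m" using trinomial_root_less_sum[OF r t'(4)] t' by simp
  hence "n \<in> set [2..8]" "m \<in> set [1..n - 1]" "l \<in> set [1..m]" "n < l + m"
    using t unfolding is_trinomial_root_def by auto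
  then obtain lo hi ts where e: "(lo, hi, ts) \<in> set root_table" "(l, m, n) \<in> set ts"
    using root_table_complete by fast
  hence sgn: "trinomial_neg lo (l, m, n)" "trinomial_pos hi (l, m, n)"
    using root_table_bounds by fast+
  have "1001 \<le> lo \<and> lo < hi" by (rule separated_lower[OF root_table_separated e(1)])
  thus thesis using that[OF e] trinomial_root_gt[OF t(1) r sgn(1)] trinomial_root_less[OF t(1) sgn(2)] by simp
qed

text \<open>Disjointness of the intervals assigns \<open>r\<close> to at most one entry;
  \<open>[]\<close> serves the \<open>r\<close> that solve no trinomial. The continuum of ratios is
  thereby reduced to finitely many cases.\<close>

lemma trinomial_root_classes:
  assumes r: "1 < r"
  shows "\<exists>ts \<in> set ([] # map (snd \<circ> snd) root_table).
    \<forall>l m n. is_trinomial_root r l m n \<longrightarrow> n \<le> 8 \<longrightarrow> (l, m, n) \<in> set ts"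
proof -
  show ?thesis
  proof (cases "\<exists>l m n. is_trinomial_root r l m n \<and> n \<le> 8")
    case True
    then obtain lo hi ts where e: "(lo, hi, ts) \<in> set root_table" "of_int lo < 1000 * r" "1000 * r < of_int hi"
      using trinomial_root_entry[OF r] by metis
    have "(l, m, n) \<in> set ts" if "is_trinomial_root r l m n" "n \<le> 8" for l m n
      using trinomial_root_entry[OF r that] separated_disjoint[OF root_table_separated e(1) _ e(2,3)] by metis
    thus ?thesis using e(1) by force
  qed auto
qed

section \<open>Sums of powers\<close>

(* Of the colliding sums r^k + r^(k+n) = r^(k+l) + r^(k+m), the one with the smallest exponent k is
   discarded. *)
fun dependent :: "(int \<times> int \<times> int) list \<Rightarrow> int list \<Rightarrow> int \<Rightarrow> int \<Rightarrow> bool" where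
  "dependent [] xs k d = False"
| "dependent ((l, m, n) # ts) xs k d =
    (if d = n then if k + l \<in> set xs then if k + m \<in> set xs then True
     else dependent ts xs k d else dependent ts xs k d else dependent ts xs k d)"

lemma dependent_iff: "dependent ts xs k d \<longleftrightarrow> (\<exists>l m. (l, m, d) \<in> set ts \<and> k + l \<in> set xs \<and> k + m \<in> set xs)"
  by (induction ts xs k d rule: dependent.induct) auto

fun indep_pairs :: "(int \<times> int \<times> int) list \<Rightarrow> int list \<Rightarrow> (int \<times> int) list \<Rightarrow> (int \<times> int) list" where
  "indep_pairs ts xs [] = []"
| "indep_pairs ts xs ((k, k') # ps) =
    (if dependent ts xs k (k' - k) then indep_pairs ts xs ps else (k, k') # indep_pairs ts xs ps)"

lemma indep_pairs_eq: "indep_pairs ts xs ps = filter (\<lambda>(k, k'). \<not> dependent ts xs k (k' - k)) ps"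
  by (induction ts xs ps rule: indep_pairs.induct) auto

definition indep_count :: "(int \<times> int \<times> int) list \<Rightarrow> int list \<Rightarrow> nat" where
  "indep_count ts xs = length (indep_pairs ts xs (map_upairs Pair xs))"

text \<open>After division by \<open>r^k\<close>, the smallest power, the equation has the form of
  the trinomial; \<open>r^(i-k) > 1\<close> forces \<open>i' < k'\<close>.\<close>

lemma power_sum_collision:
  fixes r :: real
  assumes r: "1 < r" and eq: "r powi k + r powi k' = r powi i + r powi i'"
    and le: "k \<le> k'" "i \<le> i'" "k < i"
  shows "is_trinomial_root r (i - k) (i' - k) (k' - k)"
proof -
  have "r powi k' = r powi k * r powi (k' - k)" "r powi i = r powi k * r powi (i - k)"
    "r powi i' = r powi k * r powi (i' - k)"
    using r by (simp_all flip: power_int_add)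
  hence "r powi k * (1 + r powi (k' - k)) = r powi k * (r powi (i - k) + r powi (i' - k))"
    using eq by (simp add: algebra_simps)
  hence sum: "r powi (k' - k) + 1 = r powi (i - k) + r powi (i' - k)" using r by simp
  have "1 < r powi (i - k)" using power_int_strict_increasing[OF _ r, of 0 "i - k"] le by simp
  hence "r powi (i' - k) < r powi (k' - k)" using sum by simp
  hence "i' - k < k' - k" using power_int_increasing[of "k' - k" "i' - k" r] r by force
  thus ?thesis unfolding is_trinomial_root_def using le sum by simp
qed

text \<open>If \<open>ts\<close> contains all relations of \<open>r\<close>, a retained sum never
  equals one with a larger smallest exponent, so retained sums are distinct and give a lower bound.
  If \<open>ts\<close> contains true relations only, each discarded sum equals a retained one and
  the bound is exact.\<close>

lemma card_plus_geometric:
  fixes r c :: real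
  assumes r: "1 < r" and c: "0 < c" and xs: "sorted_wrt (<) xs" "set xs \<subseteq> {0..8}"
    and A: "A = (\<lambda>k. c * r powi k) ` set xs"
    and ts: "\<And>l m n. is_trinomial_root r l m n \<Longrightarrow> n \<le> 8 \<Longrightarrow> (l, m, n) \<in> set ts"
  shows "indep_count ts xs \<le> card (A + A)"
    and "(\<And>l m n. (l, m, n) \<in> set ts \<Longrightarrow> is_trinomial_root r l m n) \<Longrightarrow> card (A + A) = indep_count ts xs"
proof -
  let ?P = "map_upairs Pair xs"
  define G where "G = set (indep_pairs ts xs ?P)"
  define s where "s p = r powi (fst p) + r powi (snd p)" for p
  have distinct: "distinct xs" using xs(1) strict_sorted_iff by blast
  have G: "(k, k') \<in> G \<longleftrightarrow> (k, k') \<in> set ?P \<and> \<not> dependent ts xs k (k' - k)" for k k'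
    unfolding G_def indep_pairs_eq by auto
  have P: "(k, k') \<in> set ?P \<longleftrightarrow> k \<in> set xs \<and> k' \<in> set xs \<and> k \<le> k'" for k k'
    using set_upairs_sorted[OF xs(1)] .
  have cG: "card G = indep_count ts xs"
    unfolding G_def indep_count_def by (rule distinct_card) (simp add: indep_pairs_eq distinct_upairs distinct)
  have A': "A = set (map (\<lambda>k. c * r powi k) xs)" using A by simp
  have "map_upairs (+) (map (\<lambda>k. c * r powi k) xs) = map (\<lambda>p. c * s p) ?P"
    unfolding map_upairs_map s_def by (subst map_upairs_conv) (simp add: case_prod_unfold distrib_left)
  hence "A + A = (*) c ` s ` set ?P"
    unfolding A' set_plus_eq by (simp add: image_image)
  moreover have "inj ((*) c)" using c by (simp add: inj_on_def)
  ultimately have card: "card (A + A) = card (s ` set ?P)"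
    by (metis card_image inj_on_subset subset_UNIV)
  have noncol: "s (k, k') \<noteq> s (i, i')" if "(k, k') \<in> G" "(i, i') \<in> set ?P" "k < i" for k k' i i'
  proof
    assume eq: "s (k, k') = s (i, i')"
    have "is_trinomial_root r (i - k) (i' - k) (k' - k)"
      by (rule power_sum_collision[OF r]) (use eq that G P in \<open>auto simp: s_def\<close>)
    moreover have "k' - k \<le> 8" using that G P xs(2) by (smt (verit) atLeastAtMost_iff subsetD)
    ultimately have "(i - k, i' - k, k' - k) \<in> set ts" by (rule ts)
    thus False using that unfolding G P dependent_iff by (metis add.commute diff_add_cancel)
  qed
  have "inj_on s G"
  proof (rule inj_onI, clarify)
    fix k k' i i' assume h: "(k, k') \<in> G" "(i, i') \<in> G" "s (k, k') = s (i, i')"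
    hence "k = i" using noncol[of k k' i i'] noncol[of i i' k k'] G by (metis linorder_neqE)
    moreover from this have "k' = i'" using h(3) r unfolding s_def
      using power_int_strict_increasing[OF _ r, of k' i'] power_int_strict_increasing[OF _ r, of i' k']
      by (metis add_left_cancel fst_conv linorder_neqE order_less_irrefl snd_conv)
    ultimately show "k = i \<and> k' = i'" by simp
  qed
  hence "card (s ` G) = indep_count ts xs" by (simp add: card_image cG)
  moreover have "G \<subseteq> set ?P" using G by auto
  hence "card (s ` G) \<le> card (s ` set ?P)" by (intro card_mono image_mono) auto
  ultimately show "indep_count ts xs \<le> card (A + A)" using card by simp
  assume true: "\<And>l m n. (l, m, n) \<in> set ts \<Longrightarrow> is_trinomial_root r l m n"
  have "s (k, k') \<in> s ` G" if "(k, k') \<in> set ?P" for k k'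
    using that
  \<comment> \<open>A relation replaces \<open>(k, k')\<close> by \<open>(k + l, k + m)\<close> with
    \<open>l > 0\<close>. The smallest exponent grows and is bounded by 8, so this ends at a
    retained pair.\<close>
  proof (induction "nat (8 - k)" arbitrary: k k' rule: less_induct)
    case less
    show ?case
    proof (cases "(k, k') \<in> G")
      case False
      then obtain l m where lm: "(l, m, k' - k) \<in> set ts" "k + l \<in> set xs" "k + m \<in> set xs"
        using less.prems G dependent_iff by blast
      note t = true[OF lm(1)]
      have "s (k, k') = r powi k * (r powi (k' - k) + 1)"
        using r unfolding s_def by (simp add: distrib_left flip: power_int_add)
      also have "\<dots> = s (k + l, k + m)"
        using t r unfolding s_def is_trinomial_root_def by (simp add: distrib_left power_int_add)
      also have "\<dots> \<in> s ` G"
        using less.hyps[of "k + l" "k + m"] t lm xs(2) P unfolding is_trinomial_root_def by force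
      finally show ?thesis .
    qed simp
  qed
  hence "s ` set ?P = s ` G" using \<open>G \<subseteq> set ?P\<close> by auto
  thus "card (A + A) = indep_count ts xs" using card \<open>card (s ` G) = indep_count ts xs\<close> by simp
qed

text \<open>The base case tests the class \<open>[]\<close> of ratios without any relation.\<close>

fun indep_at_least :: "nat \<Rightarrow> int list \<Rightarrow> (int \<times> int \<times> (int \<times> int \<times> int) list) list \<Rightarrow> bool" where
  "indep_at_least b xs [] = (b \<le> indep_count [] xs)"
| "indep_at_least b xs ((lo, hi, ts) # es) = (if b \<le> indep_count ts xs then indep_at_least b xs es else False)"

lemma indep_at_leastD:
  "indep_at_least b xs es \<Longrightarrow> ts \<in> set ([] # map (snd \<circ> snd) es) \<Longrightarrow> b \<le> indep_count ts xs"
  by (induction b xs es rule: indep_at_least.induct) (auto split: if_splits)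

section \<open>Attained and excluded pairs\<close>

lemma ln_products:
  fixes A :: "real set"
  assumes "\<And>x. x \<in> A \<Longrightarrow> 0 < x"
  shows "card (ln ` A) = card A" "card (ln ` A + ln ` A) = card (A * A)"
proof -
  have inj: "inj_on ln B" if "\<And>x. x \<in> B \<Longrightarrow> 0 < x" for B :: "real set"
    using that by (auto simp: inj_on_def)
  show "card (ln ` A) = card A" by (rule card_image[OF inj[OF assms]])
  have "ln ` A + ln ` A = ln ` (A * A)"
  proof (intro subset_antisym subsetI)
    fix z assume "z \<in> ln ` A + ln ` A"
    then obtain x y where "x \<in> A" "y \<in> A" "z = ln x + ln y" by (elim set_plus_elim imageE) simp
    thus "z \<in> ln ` (A * A)" using assms by (intro image_eqI[of _ _ "x * y"]) (simp_all add: ln_mult_pos set_times_intro)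
  next
    fix z assume "z \<in> ln ` (A * A)"
    then obtain x y where "x \<in> A" "y \<in> A" "z = ln (x * y)" by (elim set_times_elim imageE) simp
    thus "z \<in> ln ` A + ln ` A" using assms by (simp add: ln_mult_pos set_plus_intro)
  qed
  moreover have "0 < x" if "x \<in> A * A" for x using that assms by (auto elim!: set_times_elim)
  ultimately show "card (ln ` A + ln ` A) = card (A * A)" by (simp add: card_image[OF inj])
qed

lemma ln_power_int: "0 < x \<Longrightarrow> ln (x powi k) = of_int k * ln x" for x :: real
  using exp_power_int[of "ln x" k] by (metis exp_ln ln_exp)

lemma geometric_of_ln_in_ap:
  assumes ap: "in_ap n M (ln ` A)" and pos: "\<And>x. x \<in> A \<Longrightarrow> 0 < x"
  obtains c r xs where "0 < c" "1 < r" "xs \<in> set (ksets n M)" "A = (\<lambda>k. c * r powi k) ` set xs"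
proof -
  obtain a d xs where h: "0 < d" "xs \<in> set (ksets n M)" "ln ` A = (\<lambda>k. a + d * of_int k) ` set xs"
    using ap unfolding in_ap_def by blast
  have "A = exp ` ln ` A" using pos by (force simp: image_image)
  also have "\<dots> = (\<lambda>k. exp a * exp d powi k) ` set xs"
    unfolding h(3) image_image exp_add exp_power_int by (simp add: mult.commute)
  finally show thesis using that[of "exp a" "exp d" xs] h by simp
qed

lemma card_plus_le:
  fixes A :: "real set"
  assumes "finite A" "card A = n"
  shows "card (A + A) \<le> n * (n + 1) div 2" "card (A * A) \<le> n * (n + 1) div 2"
proof -
  obtain xs where xs: "A = set xs" "length xs = n" using sorted_enum[OF assms] by metis
  show "card (A + A) \<le> n * (n + 1) div 2" "card (A * A) \<le> n * (n + 1) div 2"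
    unfolding xs(1) set_plus_eq set_times_eq
    by (rule order_trans[OF card_length], simp add: length_map_upairs xs(2))+
qed

text \<open>Two consecutive exponents make \<open>r\<close> a quotient of two elements, so
  rationality passes from \<open>A\<close> to \<open>r\<close>. They occur by pigeonhole when
  \<open>n\<close> indices lie among \<open>2 n - 3\<close> consecutive integers.\<close>

fun has_step :: "int list \<Rightarrow> int list \<Rightarrow> bool" where
  "has_step xs [] = False"
| "has_step xs (k # ks) = (if k + 1 \<in> set xs then True else has_step xs ks)"

lemma has_stepD: "has_step xs ks \<Longrightarrow> \<exists>k \<in> set ks. k + 1 \<in> set xs"
  by (induction xs ks rule: has_step.induct) (auto split: if_splits)

fun geometric_ok_for :: "nat \<Rightarrow> nat \<Rightarrow> int list \<Rightarrow> bool" where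
  "geometric_ok_for n b xs = (if has_step xs xs then if 2 * n - 1 \<le> sum_count xs
     then indep_at_least b xs root_table else False else False)"

definition geometric_ok :: "nat \<Rightarrow> int \<Rightarrow> nat \<Rightarrow> bool" where
  "geometric_ok n M b \<longleftrightarrow> list_all (geometric_ok_for n b) (ksets n M)"

text \<open>The bounds 13 here and 18 below are sharp: the first five, respectively six, powers of
  the golden ratio attain them.\<close>

lemma geometric_ok5: "geometric_ok 5 6 13" by code_simp

lemma geometric_ok6: "geometric_ok 6 8 18" by code_simp

lemma sums_of_geometric:
  assumes ap: "in_ap n M (ln ` A)" and pos: "\<And>x. x \<in> A \<Longrightarrow> 0 < x"
    and ok: "geometric_ok n M b" and M: "0 \<le> M" "M \<le> 8" and n: "0 < n"
  shows "2 * n - 1 \<le> card (A * A)" "b \<le> card (A + A)"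
    "A \<subseteq> \<rat> \<Longrightarrow> n * (n + 1) div 2 \<le> card (A + A)"
proof -
  obtain c r xs where h: "0 < c" "1 < r" "xs \<in> set (ksets n M)" "A = (\<lambda>k. c * r powi k) ` set xs"
    using geometric_of_ln_in_ap[OF ap pos] .
  note k = ksetsD[OF h(3) n]
  have sub: "set xs \<subseteq> {0..8}" using k(4) M by auto
  have ok': "indep_at_least b xs root_table" "2 * n - 1 \<le> sum_count xs" "has_step xs xs"
    using ok h(3) unfolding geometric_ok_def list_all_iff by (auto split: if_splits)
  have "ln ` A = (\<lambda>k. ln c + ln r * of_int k) ` set xs"
    unfolding h(4) image_image using h(1,2) by (intro image_cong) (simp_all add: ln_mult_pos ln_power_int)
  from card_plus_ap[OF this] h(2) show "2 * n - 1 \<le> card (A * A)"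
    using ok'(2) ln_products(2)[OF pos] by simp
  obtain ts where ts: "ts \<in> set ([] # map (snd \<circ> snd) root_table)"
    "\<And>l m n. is_trinomial_root r l m n \<Longrightarrow> n \<le> 8 \<Longrightarrow> (l, m, n) \<in> set ts"
    using trinomial_root_classes[OF h(2)] by metis
  show "b \<le> card (A + A)"
    using card_plus_geometric(1)[OF h(2,1) k(1) sub h(4) ts(2)] indep_at_leastD[OF ok'(1) ts(1)] by linarith
  assume rat: "A \<subseteq> \<rat>"
  obtain i where i: "i \<in> set xs" "i + 1 \<in> set xs" using has_stepD[OF ok'(3)] by blast
  have "c * r powi (i + 1) \<in> \<rat>" "c * r powi i \<in> \<rat>" using rat i unfolding h(4) by blast+
  moreover have "r = (c * r powi (i + 1)) / (c * r powi i)" using h(1,2) by (simp add: power_int_add)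
  ultimately have r: "r \<in> \<rat>" by (metis Rats_divide)
  \<comment> \<open>A rational ratio satisfies no relation, so \<open>[]\<close> is a valid class
    and no sum is discarded.\<close>
  have "\<not> is_trinomial_root r l m n'" for l m n'
    using rational_no_trinomial_root[OF r h(2)] is_trinomial_root_nat[of r l m n'] by (meson less_le_trans le_less_trans)
  hence "indep_count [] xs \<le> card (A + A)"
    by (intro card_plus_geometric(1)[OF h(2,1) k(1) sub h(4)]) simp
  moreover have "indep_count [] xs = n * (n + 1) div 2"
    unfolding indep_count_def indep_pairs_eq by (simp add: dependent_iff length_map_upairs k(2))
  ultimately show "n * (n + 1) div 2 \<le> card (A + A)" by simp
qed

section \<open>Excluding all other pairs\<close>

definition pairs5 :: "(nat \<times> nat) set" where
  "pairs5 = {(i, j). 12 \<le> i \<and> i \<le> 15 \<and> 12 \<le> j \<and> j \<le> 15} \<union>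
           {(9, 14), (9, 15), (10, 12), (10, 14), (10, 15),
            (11, 12), (11, 14), (11, 15), (15, 9), (15, 10), (15, 11)}"

definition pairs6 :: "(nat \<times> nat) set" where
  "pairs6 = {(i, j). 15 \<le> i \<and> i \<le> 21 \<and> 15 \<le> j \<and> j \<le> 21} \<union>
           {(21, 11), (21, 12), (21, 13), (21, 14),
            (13, 15), (14, 15), (14, 19), (13, 19)} \<union>
           {(i, j). 11 \<le> i \<and> i \<le> 14 \<and> j \<in> {18, 20, 21}}"

text \<open>At most \<open>11 = 3 * 5 - 4\<close> sums put \<open>A\<close> in a short arithmetic
  progression, at most 11 products in a geometric one; otherwise both counts lie between 12 and
  15.\<close>

lemma pairs_of_positive_reals5:
  fixes A :: "real set"
  assumes A: "A \<subseteq> {x. 0 < x}" "finite A" "card A = 5"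
  shows "(card (A + A), card (A * A)) \<in> pairs5 \<union> {(i, j). 13 \<le> i \<and> i \<le> 14 \<and> 9 \<le> j \<and> j \<le> 11}"
    and "A \<subseteq> \<rat> \<Longrightarrow> card (A * A) \<le> 11 \<Longrightarrow> card (A + A) = 15"
proof -
  have pos: "\<And>x. x \<in> A \<Longrightarrow> 0 < x" using A by auto
  note le = card_plus_le[OF A(2,3)]
  have gp: "in_ap 5 6 (ln ` A)" if "card (A * A) \<le> 11"
    using in_ap5[of "ln ` A"] A that ln_products[OF pos] by simp
  note geo = sums_of_geometric[OF gp pos geometric_ok5]
  consider "card (A + A) \<le> 11" | "11 < card (A + A)" "11 < card (A * A)"
    | "card (A + A) \<le> 14" "card (A * A) \<le> 11" | "card (A + A) = 15" "card (A * A) \<le> 11"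
    using le by (simp, linarith)
  thus "(card (A + A), card (A * A)) \<in> pairs5 \<union> {(i, j). 13 \<le> i \<and> i \<le> 14 \<and> 9 \<le> j \<and> j \<le> 11}"
  proof cases
    case 1
    have "(card (A + A), card (A * A)) \<in>
        set [(9, 14), (9, 15), (10, 12), (10, 14), (10, 15), (11, 12), (11, 14), (11, 15)]"
      by (rule ap_products[OF in_ap5[OF A(2,3) 1] pos ap_products_ok5]) (use 1 in simp_all)
    moreover have "set [(9, 14), (9, 15), (10, 12), (10, 14), (10, 15), (11, 12), (11, 14), (11, 15)] \<subseteq> pairs5"
      unfolding pairs5_def by simp
    ultimately show ?thesis by blast
  next
    case 2
    thus ?thesis unfolding pairs5_def using le by (intro UnI1) simp
  next
    case 3
    thus ?thesis using geo(1,2) by (intro UnI2) simp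
  next
    case 4
    hence "card (A * A) = 9 \<or> card (A * A) = 10 \<or> card (A * A) = 11" using geo(1) by simp linarith
    thus ?thesis unfolding 4(1) pairs5_def by (elim disjE) simp_all
  qed
  show "A \<subseteq> \<rat> \<Longrightarrow> card (A * A) \<le> 11 \<Longrightarrow> card (A + A) = 15"
    using geo(3) le by simp
qed

lemma pairs_of_positive_reals6:
  fixes A :: "real set"
  assumes A: "A \<subseteq> {x. 0 < x}" "finite A" "card A = 6"
  shows "(card (A + A), card (A * A)) \<in> pairs6 \<union> {(i, j). 18 \<le> i \<and> i \<le> 20 \<and> 11 \<le> j \<and> j \<le> 14}"
    and "A \<subseteq> \<rat> \<Longrightarrow> card (A * A) \<le> 14 \<Longrightarrow> card (A + A) = 21"
proof -
  have pos: "\<And>x. x \<in> A \<Longrightarrow> 0 < x" using A by auto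
  note le = card_plus_le[OF A(2,3)]
  have gp: "in_ap 6 8 (ln ` A)" if "card (A * A) \<le> 14"
    using in_ap6[of "ln ` A"] A that ln_products[OF pos] by simp
  note geo = sums_of_geometric[OF gp pos geometric_ok6]
  consider "card (A + A) \<le> 14" | "14 < card (A + A)" "14 < card (A * A)"
    | "card (A + A) \<le> 20" "card (A * A) \<le> 14" | "card (A + A) = 21" "card (A * A) \<le> 14"
    using le by (simp, linarith)
  thus "(card (A + A), card (A * A)) \<in> pairs6 \<union> {(i, j). 18 \<le> i \<and> i \<le> 20 \<and> 11 \<le> j \<and> j \<le> 14}"
  proof cases
    case 1
    have "(card (A + A), card (A * A)) \<in>
        set ([(13, 15), (14, 15), (14, 19), (13, 19)] @ List.product [11..<15] [18, 20, 21])"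
      by (rule ap_products[OF in_ap6[OF A(2,3) 1] pos ap_products_ok6]) (use 1 in simp_all)
    moreover have "set [(13, 15), (14, 15), (14, 19), (13, 19)] \<subseteq> pairs6"
      unfolding pairs6_def by simp
    moreover have "set (List.product [11..<15] [18, 20, 21]) \<subseteq> pairs6"
      unfolding pairs6_def set_product set_upt by (rule subset_trans[OF _ Un_upper2]) auto
    ultimately show ?thesis unfolding set_append by blast
  next
    case 2
    thus ?thesis unfolding pairs6_def using le by (intro UnI1) simp
  next
    case 3
    thus ?thesis using geo(1,2) by (intro UnI2) simp
  next
    case 4
    hence "card (A * A) = 11 \<or> card (A * A) = 12 \<or> card (A * A) = 13 \<or> card (A * A) = 14"
      using geo(1) by simp linarith
    thus ?thesis unfolding 4(1) pairs6_def by (elim disjE) simp_all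
  qed
  show "A \<subseteq> \<rat> \<Longrightarrow> card (A * A) \<le> 14 \<Longrightarrow> card (A + A) = 21"
    using geo(3) le by simp
qed

section \<open>Witnesses among the positive integers\<close>

definition sp_pair :: "int list \<Rightarrow> nat \<times> nat" where
  "sp_pair xs = (sum_count xs, length (remdups (map_upairs (*) xs)))"

lemma SPP_onI:
  "A \<subseteq> X \<Longrightarrow> finite A \<Longrightarrow> card A = n \<Longrightarrow> (card (A + A), card (A * A)) \<in> SPP_on X n"
  unfolding SPP_on_def by blast

lemma sp_pair_in_SPP:
  assumes "distinct xs" "list_all (\<lambda>x. 0 < x) xs" "length xs = n"
  shows "sp_pair xs \<in> SPP n"
proof -
  define A where "A = set (map real_of_int xs)"
  have "A \<subseteq> \<nat> - {0}"
    using assms(2) unfolding A_def list_all_iff by (auto simp: Nats_altdef2)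
  moreover have "card A = n"
    unfolding A_def using assms(1,3) by (simp add: card_image inj_on_def distinct_card)
  moreover have "A + A = real_of_int ` set (map_upairs (+) xs)" "A * A = real_of_int ` set (map_upairs (*) xs)"
    unfolding A_def set_plus_eq set_times_eq map_upairs_map
    by (simp_all add: map_map_upairs flip: list.set_map)
  hence "(card (A + A), card (A * A)) = sp_pair xs"
    by (simp add: sp_pair_def sum_count_def card_image inj_on_def length_remdups_card_conv)
  moreover have "finite A" unfolding A_def by simp
  ultimately show ?thesis unfolding SPP_def using SPP_onI by metis
qed

text \<open>There is one list for each of the 27 pairs. The pairs with at most 11 products come from
  powers of 2 or 3.\<close>

definition witnesses5 :: "int list list" where
  "witnesses5 =
    [[1, 2, 3, 4, 5], [1, 4, 7, 10, 13], [1, 2, 3, 4, 6], [1, 4, 7, 10, 16],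
     [1, 3, 4, 5, 6], [2, 3, 4, 6, 8], [1, 2, 3, 4, 7], [1, 2, 3, 5, 7],
     [1, 2, 3, 4, 8], [1, 2, 3, 4, 9], [1, 2, 3, 4, 10], [1, 2, 3, 5, 8],
     [1, 2, 3, 6, 9], [1, 2, 4, 6, 9], [1, 2, 3, 5, 10], [1, 2, 3, 5, 11],
     [1, 2, 3, 6, 12], [1, 2, 3, 9, 18], [1, 2, 3, 6, 13], [1, 2, 3, 7, 10],
     [1, 2, 4, 8, 16], [27, 243, 729, 2187, 6561], [9, 81, 729, 2187, 6561], [1, 2, 4, 8, 13],
     [1, 2, 4, 11, 16], [1, 2, 4, 9, 13], [1, 2, 5, 7, 15]]"

text \<open>There is one list for each of the 69 pairs. Powers of 3 supply those with at most 14
  products.\<close>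

definition witnesses6 :: "int list list" where
  "witnesses6 =
    [[1, 2, 3, 4, 5, 6], [1, 3, 5, 7, 9, 11], [2, 5, 8, 11, 14, 17], [2, 3, 4, 5, 6, 8],
     [1, 2, 3, 4, 5, 7], [1, 3, 4, 5, 6, 7], [1, 2, 3, 4, 6, 8], [1, 2, 3, 4, 5, 8],
     [2, 4, 6, 7, 8, 9], [1, 2, 3, 5, 6, 7], [1, 3, 5, 6, 7, 8], [1, 2, 3, 4, 6, 9],
     [1, 2, 3, 4, 7, 8], [1, 2, 3, 4, 5, 9], [1, 2, 3, 5, 6, 8], [1, 2, 5, 6, 7, 8],
     [2, 3, 4, 6, 8, 12], [2, 3, 4, 6, 8, 9], [1, 2, 3, 4, 8, 9], [1, 2, 3, 4, 5, 10],
     [1, 2, 3, 4, 5, 12], [1, 2, 3, 4, 5, 11], [1, 2, 3, 5, 7, 8], [1, 2, 3, 4, 6, 12],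
     [1, 2, 3, 4, 6, 18], [1, 2, 3, 4, 6, 16], [1, 2, 3, 4, 6, 13], [1, 2, 3, 4, 7, 12],
     [1, 2, 3, 4, 7, 11], [1, 2, 3, 5, 7, 12], [1, 2, 4, 5, 8, 10], [1, 2, 3, 4, 8, 12],
     [1, 2, 3, 4, 9, 12], [1, 2, 3, 4, 7, 14], [1, 2, 3, 4, 7, 16], [1, 2, 3, 4, 7, 15],
     [1, 2, 3, 5, 7, 16], [1, 2, 3, 4, 8, 16], [1, 2, 4, 5, 8, 20], [1, 2, 3, 4, 9, 18],
     [1, 2, 3, 4, 8, 17], [1, 2, 3, 4, 9, 13], [1, 2, 3, 4, 10, 14], [1, 2, 3, 5, 8, 17],
     [1, 2, 3, 6, 9, 18], [1, 2, 3, 6, 12, 18], [1, 2, 4, 5, 10, 16], [1, 2, 3, 5, 10, 20],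
     [1, 2, 3, 7, 9, 18], [1, 2, 3, 5, 10, 16], [1, 2, 3, 5, 11, 16], [1, 2, 4, 5, 10, 20],
     [6, 16, 24, 32, 64, 128], [1, 2, 4, 10, 16, 20], [1, 2, 3, 6, 12, 19], [1, 2, 3, 9, 13, 18],
     [1, 2, 3, 6, 13, 19], [1, 2, 3, 7, 15, 18], [9, 27, 81, 243, 729, 2187], [1, 3, 9, 27, 81, 729],
     [9, 81, 729, 2187, 6561, 19683], [1, 9, 27, 81, 243, 6561], [3, 9, 81, 243, 729, 19683], [1, 3, 9, 243, 729, 6561],
     [9, 15, 27, 81, 243, 6561], [1, 2, 4, 8, 256, 1280], [1, 2, 6, 9, 18, 20], [1, 2, 4, 9, 13, 19],
     [1, 2, 5, 11, 13, 18]]"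

lemma witnesses_valid:
  "list_all (\<lambda>xs. distinct xs \<and> list_all (\<lambda>x. 0 < x) xs \<and> length xs = 5) witnesses5"
  "list_all (\<lambda>xs. distinct xs \<and> list_all (\<lambda>x. 0 < x) xs \<and> length xs = 6) witnesses6"
  by code_simp+

lemma witnesses5_pairs:
  "set (map sp_pair witnesses5) = set (List.product [12..<16] [12..<16] @
    [(9, 14), (9, 15), (10, 12), (10, 14), (10, 15),
     (11, 12), (11, 14), (11, 15), (15, 9), (15, 10), (15, 11)])"
  by code_simp

lemma witnesses6_pairs:
  "set (map sp_pair witnesses6) =
    set ((List.product [15..<22] [15..<22] @
      [(21, 11), (21, 12), (21, 13), (21, 14), (13, 15), (14, 15), (14, 19), (13, 19)]) @
      List.product [11..<15] [18, 20, 21])"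
  by code_simp

section \<open>Witnesses from powers of trinomial roots\<close>

lemma trinomial_root_exists:
  assumes e: "(lo, hi, ts) \<in> set root_table" "(l, m, n) \<in> set ts" and lmn: "0 < l" "l \<le> m" "m < n"
  obtains r where "1 < r" "is_trinomial_root r l m n" "of_int lo < 1000 * r" "1000 * r < of_int hi"
proof -
  have sgn: "trinomial_neg lo (l, m, n)" "trinomial_pos hi (l, m, n)" using e root_table_bounds by fast+
  have lohi: "1001 \<le> lo \<and> lo < hi" by (rule separated_lower[OF root_table_separated e(1)])
  define f where "f x = x ^ nat n + 1 - x ^ nat l - x ^ nat m" for x :: real
  have "f (lo / 1000) < 0" "0 < f (hi / 1000)"
    using sgn unfolding trinomial_neg_iff[OF lmn] trinomial_pos_iff[OF lmn] f_def by linarith+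
  moreover have "continuous_on {lo / 1000..hi / 1000} f" unfolding f_def by (intro continuous_intros)
  ultimately obtain r where r: "of_int lo / 1000 \<le> r" "r \<le> of_int hi / 1000" "f r = 0"
    using IVT'[of f "lo / 1000" 0 "hi / 1000"] lohi by force
  have t: "is_trinomial_root r l m n"
    using r(3) lmn unfolding f_def is_trinomial_root_def by (simp add: power_int_nonneg_exp)
  have "1 < r" using r(1) lohi by simp
  thus thesis using that t trinomial_root_gt[OF t _ sgn(1)] trinomial_root_less[OF t sgn(2)] lohi by simp
qed

text \<open>The trinomial of \<open>(2, 3, 4)\<close> is \<open>(r - 1) (r^3 - r - 1)\<close>, and
  \<open>r^3 = r + 1\<close> implies the other two relations of its table entry.\<close>

lemma plastic_roots:
  assumes r: "1 < r" and t: "is_trinomial_root r 2 3 4"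
  shows "is_trinomial_root r 3 5 6" "is_trinomial_root r 5 5 7"
proof -
  have "r ^ 4 + 1 = r ^ 2 + r ^ 3" using t unfolding is_trinomial_root_def by simp
  hence "(r - 1) * (r ^ 3 - r - 1) = 0" by algebra
  hence "r ^ 3 = r + 1" using r by simp
  hence "r ^ 6 + 1 = r ^ 3 + r ^ 5" "r ^ 7 + 1 = r ^ 5 + r ^ 5" by algebra+
  thus "is_trinomial_root r 3 5 6" "is_trinomial_root r 5 5 7" unfolding is_trinomial_root_def by simp_all
qed

text \<open>At a root of the first trinomial of \<open>ts\<close>, disjointness of the intervals
  excludes relations outside \<open>ts\<close>, and all those in \<open>ts\<close> hold. The number
  of sums of its powers is therefore exactly \<open>indep_count ts xs\<close>.\<close>

lemma geometric_pair_in_SPP_on: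
  assumes e: "(lo, hi, ts) \<in> set root_table" and ts: "ts = [t] \<or> ts = [(2, 3, 4), (3, 5, 6), (5, 5, 7)]"
    and xs: "sorted_wrt (<) xs" "set xs \<subseteq> {0..8}" "length xs = N"
  shows "(indep_count ts xs, sum_count xs) \<in> SPP_on {x. 0 < x} N"
proof -
  have range: "0 < l \<and> l \<le> m \<and> m < n \<and> n \<le> 8" if "(l, m, n) \<in> set ts" for l m n
  proof -
    have "\<forall>(lo, hi, ts) \<in> set root_table. \<forall>(l, m, n) \<in> set ts. 0 < l \<and> l \<le> m \<and> m < n \<and> n \<le> 8"
      by code_simp
    thus ?thesis using e that by fast
  qed
  obtain l m n where lmn: "ts = (l, m, n) # tl ts" using ts by (cases ts; cases t) auto
  hence mem: "(l, m, n) \<in> set ts" by (metis list.set_intros(1))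
  obtain r where r: "1 < r" "is_trinomial_root r l m n" "of_int lo < 1000 * r" "1000 * r < of_int hi"
    using trinomial_root_exists[OF e mem] range[OF mem] by blast
  have only: "(l, m, n) \<in> set ts" if "is_trinomial_root r l m n" "n \<le> 8" for l m n
    using trinomial_root_entry[OF r(1) that] separated_disjoint[OF root_table_separated e _ r(3,4)] by metis
  have all: "is_trinomial_root r l' m' n'" if "(l', m', n') \<in> set ts" for l' m' n'
    using ts that lmn r(2) plastic_roots[OF r(1)] by auto
  define A where "A = (\<lambda>k. 1 * r powi k) ` set xs"
  have ln: "ln ` A = (\<lambda>k. 0 + ln r * of_int k) ` set xs"
    unfolding A_def image_image using r(1) by (simp add: ln_power_int mult.commute)
  have pos: "\<And>x. x \<in> A \<Longrightarrow> 0 < x" using r(1) unfolding A_def by auto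
  have "card (A + A) = indep_count ts xs"
    using card_plus_geometric(2)[OF r(1) _ xs(1,2) A_def only] all by simp
  moreover have "card (A * A) = sum_count xs"
    using card_plus_ap[OF ln] r(1) ln_products(2)[OF pos] by simp
  moreover have "card A = N"
  proof -
    have "inj_on (\<lambda>k. 0 + ln r * real_of_int k) (set xs)" using r(1) by (simp add: inj_on_def)
    hence "card (ln ` A) = card (set xs)" unfolding ln by (rule card_image)
    moreover have "distinct xs" using xs(1) strict_sorted_iff by blast
    ultimately show ?thesis using ln_products(1)[OF pos] xs(3) by (simp add: distinct_card)
  qed
  moreover have "finite A" unfolding A_def by simp
  moreover have "A \<subseteq> {x. 0 < x}" using pos by auto
  ultimately show ?thesis using SPP_onI by metis
qed

(* Powers of the golden ratio (2, 2, 3), of the tribonacci constant (3, 3, 4), of the plastic number,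
   and of the root of (4, 4, 5). *)
definition geometric_witnesses5 :: "((int \<times> int \<times> int) list \<times> int list) list" where
  "geometric_witnesses5 =
    [([(2, 2, 3)], [0, 1, 2, 3, 4]), ([(2, 2, 3)], [0, 2, 3, 4, 5]), ([(3, 3, 4)], [0, 1, 3, 4, 5]),
     ([(3, 3, 4)], [0, 1, 2, 3, 4]), ([(2, 2, 3)], [0, 1, 2, 3, 5]), ([(2, 2, 3)], [0, 1, 2, 3, 6])]"

definition geometric_witnesses6 :: "((int \<times> int \<times> int) list \<times> int list) list" where
  "geometric_witnesses6 =
    [([(2, 2, 3)], [0, 1, 2, 3, 4, 5]), ([(2, 2, 3)], [0, 2, 3, 4, 5, 6]),
     ([(2, 3, 4), (3, 5, 6), (5, 5, 7)], [0, 3, 4, 5, 6, 7]), ([(3, 3, 4)], [0, 3, 4, 6, 7, 8]),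
     ([(3, 3, 4)], [0, 1, 2, 3, 4, 5]), ([(2, 2, 3)], [0, 1, 2, 3, 4, 6]),
     ([(2, 2, 3)], [0, 1, 2, 3, 4, 7]), ([(2, 2, 3)], [0, 1, 2, 3, 4, 8]),
     ([(4, 4, 5)], [0, 1, 2, 3, 4, 5]), ([(3, 3, 4)], [0, 1, 2, 3, 4, 6]),
     ([(3, 3, 4)], [0, 1, 2, 3, 4, 7]), ([(3, 3, 4)], [0, 1, 2, 3, 4, 8])]"

definition geometric_valid :: "nat \<Rightarrow> (int \<times> int \<times> int) list \<times> int list \<Rightarrow> bool" where
  "geometric_valid n w \<longleftrightarrow> fst w \<in> set (map (snd \<circ> snd) root_table) \<and>
    (length (fst w) = 1 \<or> fst w = [(2, 3, 4), (3, 5, 6), (5, 5, 7)]) \<and>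
    sorted_wrt (<) (snd w) \<and> list_all (\<lambda>k. 0 \<le> k \<and> k \<le> 8) (snd w) \<and> length (snd w) = n"

lemma geometric_witnesses_valid:
  "list_all (geometric_valid 5) geometric_witnesses5" "list_all (geometric_valid 6) geometric_witnesses6"
  by (simp_all add: geometric_witnesses5_def geometric_witnesses6_def geometric_valid_def root_table_def)

lemma geometric_valid_in_SPP_on:
  assumes "geometric_valid n w"
  shows "(indep_count (fst w) (snd w), sum_count (snd w)) \<in> SPP_on {x. 0 < x} n"
proof -
  have v: "fst w \<in> set (map (snd \<circ> snd) root_table)" "length (fst w) = 1 \<or> fst w = [(2, 3, 4), (3, 5, 6), (5, 5, 7)]"
    "sorted_wrt (<) (snd w)" "set (snd w) \<subseteq> {0..8}" "length (snd w) = n"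
    using assms unfolding geometric_valid_def list_all_iff by auto
  obtain lo hi where "(lo, hi, fst w) \<in> set root_table" using v(1) by auto
  moreover obtain t where "fst w = [t] \<or> fst w = [(2, 3, 4), (3, 5, 6), (5, 5, 7)]"
    using v(2) by (auto simp: length_Suc_conv)
  ultimately show ?thesis using v(3-5) by (rule geometric_pair_in_SPP_on)
qed

lemma geometric_witnesses_pairs:
  "map (\<lambda>w. (indep_count (fst w) (snd w), sum_count (snd w))) geometric_witnesses5 =
    List.product [13..<15] [9..<12]"
  "map (\<lambda>w. (indep_count (fst w) (snd w), sum_count (snd w))) geometric_witnesses6 =
    List.product [18..<21] [11..<15]"
  by code_simp+

section \<open>The four equalities\<close>

lemma SPP_subset_SPP_on_pos: "SPP n \<subseteq> SPP_on {x. 0 < x} n"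
proof -
  have "\<nat> - {0} \<subseteq> {x :: real. 0 < x}" by (auto elim!: Nats_cases)
  thus ?thesis unfolding SPP_def SPP_on_def by blast
qed

lemma set_map_subset_if_list_all:
  assumes "list_all P ws" "\<And>w. P w \<Longrightarrow> f w \<in> S"
  shows "set (map f ws) \<subseteq> S"
  using assms by (auto simp: list_all_iff)

lemma SPP5: "SPP 5 = pairs5"
proof
  show "SPP 5 \<subseteq> pairs5"
  proof
    fix p assume "p \<in> SPP 5"
    then obtain A :: "real set" where A: "p = (card (A + A), card (A * A))" "A \<subseteq> \<nat> - {0}" "finite A" "card A = 5"
      unfolding SPP_def SPP_on_def by blast
    have "A \<subseteq> {x. 0 < x}" "A \<subseteq> \<rat>" using A(2) Nats_subset_Rats by (auto elim!: Nats_cases)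
    \<comment> \<open>Rationality forces 15 sums when there are at most 11 products, which removes
      the additional pairs of the real case.\<close>
    from pairs_of_positive_reals5(1)[OF this(1) A(3,4)] pairs_of_positive_reals5(2)[OF this(1) A(3,4) this(2)]
    show "p \<in> pairs5" unfolding A(1) by (elim UnE) simp_all
  qed
  have "pairs5 \<subseteq> set (map sp_pair witnesses5)"
    unfolding pairs5_def witnesses5_pairs set_append set_product set_upt by (intro Un_mono) auto
  also have "\<dots> \<subseteq> SPP 5"
    by (rule set_map_subset_if_list_all[OF witnesses_valid(1)]) (simp add: sp_pair_in_SPP)
  finally show "pairs5 \<subseteq> SPP 5" .
qed

lemma SPP_on_pos5: "SPP_on {x. 0 < x} 5 = SPP 5 \<union> {(i, j). 13 \<le> i \<and> i \<le> 14 \<and> 9 \<le> j \<and> j \<le> 11}"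
proof
  show "SPP_on {x. 0 < x} 5 \<subseteq> SPP 5 \<union> {(i, j). 13 \<le> i \<and> i \<le> 14 \<and> 9 \<le> j \<and> j \<le> 11}"
    unfolding SPP5 SPP_on_def using pairs_of_positive_reals5(1) by blast
  have "{(i, j). 13 \<le> i \<and> i \<le> 14 \<and> 9 \<le> j \<and> j \<le> 11} \<subseteq> set (List.product [13..<15] [9..<12])"
    unfolding set_product set_upt by auto
  also have "\<dots> \<subseteq> SPP_on {x. 0 < x} 5"
    unfolding geometric_witnesses_pairs(1)[symmetric]
    by (rule set_map_subset_if_list_all[OF geometric_witnesses_valid(1)]) (rule geometric_valid_in_SPP_on)
  finally show "SPP 5 \<union> {(i, j). 13 \<le> i \<and> i \<le> 14 \<and> 9 \<le> j \<and> j \<le> 11} \<subseteq> SPP_on {x. 0 < x} 5"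
    using SPP_subset_SPP_on_pos by blast
qed

lemma SPP6: "SPP 6 = pairs6"
proof
  show "SPP 6 \<subseteq> pairs6"
  proof
    fix p assume "p \<in> SPP 6"
    then obtain A :: "real set" where A: "p = (card (A + A), card (A * A))" "A \<subseteq> \<nat> - {0}" "finite A" "card A = 6"
      unfolding SPP_def SPP_on_def by blast
    have "A \<subseteq> {x. 0 < x}" "A \<subseteq> \<rat>" using A(2) Nats_subset_Rats by (auto elim!: Nats_cases)
    from pairs_of_positive_reals6(1)[OF this(1) A(3,4)] pairs_of_positive_reals6(2)[OF this(1) A(3,4) this(2)]
    show "p \<in> pairs6" unfolding A(1) by (elim UnE) simp_all
  qed
  have "pairs6 \<subseteq> set (map sp_pair witnesses6)"
    unfolding pairs6_def witnesses6_pairs set_append set_product set_upt by (intro Un_mono) auto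
  also have "\<dots> \<subseteq> SPP 6"
    by (rule set_map_subset_if_list_all[OF witnesses_valid(2)]) (simp add: sp_pair_in_SPP)
  finally show "pairs6 \<subseteq> SPP 6" .
qed

lemma SPP_on_pos6: "SPP_on {x. 0 < x} 6 = SPP 6 \<union> {(i, j). 18 \<le> i \<and> i \<le> 20 \<and> 11 \<le> j \<and> j \<le> 14}"
proof
  show "SPP_on {x. 0 < x} 6 \<subseteq> SPP 6 \<union> {(i, j). 18 \<le> i \<and> i \<le> 20 \<and> 11 \<le> j \<and> j \<le> 14}"
    unfolding SPP6 SPP_on_def using pairs_of_positive_reals6(1) by blast
  have "{(i, j). 18 \<le> i \<and> i \<le> 20 \<and> 11 \<le> j \<and> j \<le> 14} \<subseteq> set (List.product [18..<21] [11..<15])"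
    unfolding set_product set_upt by auto
  also have "\<dots> \<subseteq> SPP_on {x. 0 < x} 6"
    unfolding geometric_witnesses_pairs(2)[symmetric]
    by (rule set_map_subset_if_list_all[OF geometric_witnesses_valid(2)]) (rule geometric_valid_in_SPP_on)
  finally show "SPP 6 \<union> {(i, j). 18 \<le> i \<and> i \<le> 20 \<and> 11 \<le> j \<and> j \<le> 14} \<subseteq> SPP_on {x. 0 < x} 6"
    using SPP_subset_SPP_on_pos by blast
qed

theorem theorem6:
  shows "(SPP 5 =
           {(i, j). 12 \<le> i \<and> i \<le> 15 \<and> 12 \<le> j \<and> j \<le> 15} \<union>
           {(9, 14), (9, 15), (10, 12), (10, 14), (10, 15),
            (11, 12), (11, 14), (11, 15), (15, 9), (15, 10), (15, 11)}) \<and>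
         (SPP 6 =
           {(i, j). 15 \<le> i \<and> i \<le> 21 \<and> 15 \<le> j \<and> j \<le> 21} \<union>
           {(21, 11), (21, 12), (21, 13), (21, 14),
            (13, 15), (14, 15), (14, 19), (13, 19)} \<union>
           {(i, j). 11 \<le> i \<and> i \<le> 14 \<and> j \<in> {18, 20, 21}}) \<and>
         (SPP_on {x. 0 < x} 5 =
           SPP 5 \<union> {(i, j). 13 \<le> i \<and> i \<le> 14 \<and> 9 \<le> j \<and> j \<le> 11}) \<and>
         (SPP_on {x. 0 < x} 6 =
           SPP 6 \<union> {(i, j). 18 \<le> i \<and> i \<le> 20 \<and> 11 \<le> j \<and> j \<le> 14})"
  using SPP5 SPP6 SPP_on_pos5 SPP_on_pos6 unfolding pairs5_def pairs6_def by (intro conjI)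

end
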